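(* Let $f:\mathbb{R}^d\to(-\infty,\infty]$ be a proper closed convex function, let $\mathcal{X}\subseteq\mathbb{R}^d$ be a non-empty closed convex set, let $f^\star=\inf_{x\in\mathcal{X}}f(x)$, let $h:\mathbb{R}^d\to(-\infty,\infty]$ be convex, let $\|\cdot\|$ be a norm on $\mathbb{R}^d$ with dual norm $\|\cdot\|_*$, and for each $x\in\mathcal{X}\cap\operatorname{int}\operatorname{dom}h$ let $g(x)$ be a (fixed choice of) subgradient of $f$ at $x$. Assume: 1. $f^\star$ is finite. 2. $h$ is Legendre and $\mathcal{X}\cap\operatorname{dom}f$ is contained in the closure of $\operatorname{dom}h$. 3. The relative interior of $\operatorname{dom}f$ contains $\mathcal{X}\cap\operatorname{int}\operatorname{dom}h$. 4. $D_h(x,y)\ge\frac12\|y-x\|^2$ for all $x,y\in\mathcal{X}\cap\operatorname{int}\operatorname{dom}h$. 5. The mapping $g(\cdot)$ is bounded on every compact subset of $\mathcal{X}\cap\operatorname{int}\operatorname{dom}h$. Let $\delta_1>0$, $B>0$, $c>1/2$, $x_1\in\mathcal{X}\cap\operatorname{int}\operatorname{dom}h$, and initialize $\sigma_1=0$, $l=1$, $k(1)=1$. Generate iterates by the following algorithm, where $l$ is a counter variable updated during the run: for $k=1,2,3,\dots$, (i) if $g(x_k)=0$, return $x_k$ as a minimizer and terminate; (ii) set $f^{\mathrm{rec}}_k=\min_{1\le\kappa\le k}f(x_\kappa)$; (iii) if $f(x_k)\le f^{\mathrm{rec}}_{k(l)}-\frac12\delta_l$, then set $k(l+1)\leftarrow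 k$, $\sigma_k\leftarrow0$, $\delta_{l+1}\leftarrow\delta_l$, and then $l\leftarrow l+1$; otherwise, if $\sigma_k>B$, then set $k(l+1)\leftarrow k$, $\sigma_k\leftarrow0$, $\delta_{l+1}\leftarrow\frac12\delta_l$, and then $l\leftarrow l+1$; (iv) (with the current value of $l$) set $\hat f_k=f^{\mathrm{rec}}_{k(l)}-\delta_l$; (v) set $\eta_k=\dfrac{f(x_k)-\hat f_k}{c\,\|g(x_k)\|_*^2}$; (vi) set $x_{k+1}=T(x_k;\eta_k)$; (vii) set $\sigma_{k+1}=\sigma_k+c\,\eta_k\|g(x_k)\|_*$. Then $$\inf_{k}f(x_k)=f^\star,$$ where the infimum is over all generated iterates (all $k\in\mathbb{N}$ if the algorithm never terminates).
   Context: The Bregman divergence associated with $h$ is $D_h(x,y)=h(x)-h(y)-\langle\nabla h(y),x-y\rangle$ for $(x,y)\in\operatorname{dom}h\times\operatorname{dom}\nabla h$. For $x\in\mathcal{X}\cap\operatorname{int}\operatorname{dom}h$ and a step size $\eta>0$, $T(x;\eta)$ denotes a solution of the minimization problem $$\min_{y\in\mathcal{X}}\ \langle g(x),y-x\rangle+\frac{D_h(y,x)}{\eta}$$ (the mirror descent step). A function $h$ is Legendre if it is proper, closed, convex, essentially smooth (its domain has non-empty interior, it is differentiable on $\operatorname{int}\operatorname{dom}h$, and $\|\nabla h(x_n)\|\to\infty$ whenever $(x_n)\subset\operatorname{int}\operatorname{dom}h$ converges to a boundary point of $\operatorname{dom}h$) and essentially strictly convex (strictly convex on every convex subset of the domain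 of its subdifferential). In particular $\operatorname{dom}\nabla h=\operatorname{int}\operatorname{dom}h$. *)

theory Defs
  imports "HOL-Analysis.Analysis"
begin

text \<open>Functions with values in \<open>(-\<infinity>, \<infinity>]\<close> are represented as \<^typ>\<open>ereal\<close>-valued functions on the
  whole space that avoid \<open>-\<infinity>\<close>; convexity and closedness are those of the epigraph.\<close>

definition effective_domain :: "('a \<Rightarrow> ereal) \<Rightarrow> 'a set" where
  "effective_domain f = {x. f x < \<infinity>}"

definition ereal_epigraph :: "('a \<Rightarrow> ereal) \<Rightarrow> ('a \<times> real) set" where
  "ereal_epigraph f = {(x, r). f x \<le> ereal r}"

definition proper_fun :: "('a \<Rightarrow> ereal) \<Rightarrow> bool" where
  "proper_fun f \<longleftrightarrow> (\<forall>x. f x \<noteq> -\<infinity>) \<and> effective_domain f \<noteq> {}"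

definition closed_fun :: "('a::euclidean_space \<Rightarrow> ereal) \<Rightarrow> bool" where
  "closed_fun f \<longleftrightarrow> closed (ereal_epigraph f)"

definition convex_fun :: "('a::euclidean_space \<Rightarrow> ereal) \<Rightarrow> bool" where
  "convex_fun f \<longleftrightarrow> convex (ereal_epigraph f)"

definition subdifferential :: "('a::euclidean_space \<Rightarrow> ereal) \<Rightarrow> 'a \<Rightarrow> 'a set" where
  "subdifferential f x = {v. \<forall>y. f y \<ge> f x + ereal (v \<bullet> (y - x))}"

text \<open>The gradient is only meaningful where the real-valued restriction of \<open>h\<close> is differentiable,
  in particular only at interior points of the effective domain.\<close>

definition grad :: "('a::euclidean_space \<Rightarrow> ereal) \<Rightarrow> 'a \<Rightarrow> 'a" where
  "grad h x = (THE v. GDERIV (\<lambda>y. real_of_ereal (h y)) x :> v)"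

definition essentially_smooth :: "('a::euclidean_space \<Rightarrow> ereal) \<Rightarrow> bool" where
  "essentially_smooth h \<longleftrightarrow>
     interior (effective_domain h) \<noteq> {} \<and>
     (\<forall>x\<in>interior (effective_domain h). (\<lambda>y. real_of_ereal (h y)) differentiable (at x)) \<and>
     (\<forall>u x. (\<forall>n::nat. u n \<in> interior (effective_domain h)) \<and> u \<longlonglongrightarrow> x \<and>
        x \<in> frontier (effective_domain h) \<longrightarrow>
        filterlim (\<lambda>n. norm (grad h (u n))) at_top sequentially)"

definition strictly_convex_on :: "'a::euclidean_space set \<Rightarrow> ('a \<Rightarrow> ereal) \<Rightarrow> bool" where
  "strictly_convex_on C h \<longleftrightarrow>
     (\<forall>x\<in>C. \<forall>y\<in>C. \<forall>t::real. x \<noteq> y \<and> 0 < t \<and> t < 1 \<longrightarrow>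
        h ((1 - t) *\<^sub>R x + t *\<^sub>R y) < ereal (1 - t) * h x + ereal t * h y)"

definition essentially_strictly_convex :: "('a::euclidean_space \<Rightarrow> ereal) \<Rightarrow> bool" where
  "essentially_strictly_convex h \<longleftrightarrow>
     (\<forall>C. convex C \<and> C \<subseteq> {x. subdifferential h x \<noteq> {}} \<longrightarrow> strictly_convex_on C h)"

definition legendre_fun :: "('a::euclidean_space \<Rightarrow> ereal) \<Rightarrow> bool" where
  "legendre_fun h \<longleftrightarrow> proper_fun h \<and> closed_fun h \<and> convex_fun h \<and>
     essentially_smooth h \<and> essentially_strictly_convex h"

text \<open>\<open>bregman h x y\<close> is meaningful for \<open>y\<close> in the interior of the effective domain of a Legendre
  function; as a function of \<open>x\<close> it is \<open>\<infinity>\<close> outside the effective domain.\<close>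

definition bregman :: "('a::euclidean_space \<Rightarrow> ereal) \<Rightarrow> 'a \<Rightarrow> 'a \<Rightarrow> ereal" where
  "bregman h x y = h x - h y - ereal (grad h y \<bullet> (x - y))"

definition is_norm :: "('a::euclidean_space \<Rightarrow> real) \<Rightarrow> bool" where
  "is_norm N \<longleftrightarrow> (\<forall>x. N x \<ge> 0) \<and> (\<forall>x. N x = 0 \<longleftrightarrow> x = 0) \<and>
     (\<forall>a x. N (a *\<^sub>R x) = \<bar>a\<bar> * N x) \<and> (\<forall>x y. N (x + y) \<le> N x + N y)"

definition dual_norm :: "('a::euclidean_space \<Rightarrow> real) \<Rightarrow> 'a \<Rightarrow> real" where
  "dual_norm N z = (SUP x\<in>{x. N x \<le> 1}. z \<bullet> x)"

definition mirror_descent_solution ::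
    "'a::euclidean_space set \<Rightarrow> ('a \<Rightarrow> ereal) \<Rightarrow> ('a \<Rightarrow> 'a) \<Rightarrow> 'a \<Rightarrow> real \<Rightarrow> 'a \<Rightarrow> bool" where
  "mirror_descent_solution X h g x \<eta> z \<longleftrightarrow>
     is_arg_min (\<lambda>y. ereal (g x \<bullet> (y - x)) + bregman h y x / ereal \<eta>) (\<lambda>y. y \<in> X) z"

text \<open>The memory of the algorithm. \<open>iter\<close>, \<open>path\<close>, \<open>level\<close>, \<open>mark\<close> and \<open>counter\<close> hold
  \<open>x\<^sub>k\<close>, \<open>\<sigma>\<^sub>k\<close>, \<open>\<delta>\<^sub>l\<close>, \<open>k(l)\<close> and \<open>l\<close>. All indices start at 1; array entries that have not been
  assigned yet are irrelevant.\<close>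

record 'a md_state =
  iter :: "nat \<Rightarrow> 'a"
  path :: "nat \<Rightarrow> real"
  level :: "nat \<Rightarrow> real"
  mark :: "nat \<Rightarrow> nat"
  counter :: nat

definition md_init :: "real \<Rightarrow> 'a \<Rightarrow> 'a md_state" where
  "md_init \<delta>1 x1 = \<lparr>iter = (\<lambda>_. x1), path = (\<lambda>_. 0), level = (\<lambda>_. \<delta>1), mark = (\<lambda>_. 1), counter = 1\<rparr>"

definition f_rec :: "('a \<Rightarrow> ereal) \<Rightarrow> 'a md_state \<Rightarrow> nat \<Rightarrow> ereal" where
  "f_rec f s k = Min ((\<lambda>\<kappa>. f (iter s \<kappa>)) ` {1..k})"

definition new_level :: "nat \<Rightarrow> real \<Rightarrow> 'a md_state \<Rightarrow> 'a md_state" where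
  "new_level k \<delta> s = s\<lparr>mark := (mark s)(counter s + 1 := k),
     path := (path s)(k := 0),
     level := (level s)(counter s + 1 := \<delta>),
     counter := counter s + 1\<rparr>"

definition adjust_level ::
    "('a \<Rightarrow> ereal) \<Rightarrow> real \<Rightarrow> nat \<Rightarrow> 'a md_state \<Rightarrow> 'a md_state" where
  "adjust_level f B k s =
     (let l = counter s in
      if f (iter s k) \<le> f_rec f s (mark s l) - ereal (level s l / 2)
        then new_level k (level s l) s
      else if path s k > B
        then new_level k (level s l / 2) s
      else s)"

text \<open>The conversion to \<^typ>\<open>real\<close> is harmless: \<open>f\<close> is finite at the iterates.\<close>

definition step_size ::
    "('a::euclidean_space \<Rightarrow> ereal) \<Rightarrow> ('a \<Rightarrow> 'a) \<Rightarrow> ('a \<Rightarrow> real) \<Rightarrow> real \<Rightarrow> nat \<Rightarrow> 'a md_state \<Rightarrow> real" where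
  "step_size f g N c k s =
     (let l = counter s; f_hat = f_rec f s (mark s l) - ereal (level s l) in
      real_of_ereal (f (iter s k) - f_hat) / (c * (dual_norm N (g (iter s k)))\<^sup>2))"

definition advance ::
    "('a::euclidean_space \<Rightarrow> ereal) \<Rightarrow> ('a \<Rightarrow> 'a) \<Rightarrow> ('a \<Rightarrow> real) \<Rightarrow> ('a \<Rightarrow> real \<Rightarrow> 'a) \<Rightarrow> real \<Rightarrow>
     nat \<Rightarrow> 'a md_state \<Rightarrow> 'a md_state" where
  "advance f g N T c k s =
     (let \<eta> = step_size f g N c k s in
      s\<lparr>iter := (iter s)(k + 1 := T (iter s k) \<eta>),
        path := (path s)(k + 1 := path s k + c * \<eta> * dual_norm N (g (iter s k)))\<rparr>)"

text \<open>\<open>md_reaches f g N T \<delta>1 B c x1 k s\<close>: the run enters iteration \<open>k\<close> with memory \<open>s\<close>. The run ends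
  at the first iteration with \<open>g x\<^sub>k = 0\<close>, so no larger \<open>k\<close> is reached then.\<close>

inductive md_reaches ::
    "('a::euclidean_space \<Rightarrow> ereal) \<Rightarrow> ('a \<Rightarrow> 'a) \<Rightarrow> ('a \<Rightarrow> real) \<Rightarrow> ('a \<Rightarrow> real \<Rightarrow> 'a) \<Rightarrow>
     real \<Rightarrow> real \<Rightarrow> real \<Rightarrow> 'a \<Rightarrow> nat \<Rightarrow> 'a md_state \<Rightarrow> bool"
  for f g N T \<delta>1 B c x1 where
  start: "md_reaches f g N T \<delta>1 B c x1 1 (md_init \<delta>1 x1)"
| step: "md_reaches f g N T \<delta>1 B c x1 k s \<Longrightarrow> g (iter s k) \<noteq> 0 \<Longrightarrow>
    md_reaches f g N T \<delta>1 B c x1 (k + 1) (advance f g N T c k (adjust_level f B k s))"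

definition md_iterates ::
    "('a::euclidean_space \<Rightarrow> ereal) \<Rightarrow> ('a \<Rightarrow> 'a) \<Rightarrow> ('a \<Rightarrow> real) \<Rightarrow> ('a \<Rightarrow> real \<Rightarrow> 'a) \<Rightarrow>
     real \<Rightarrow> real \<Rightarrow> real \<Rightarrow> 'a \<Rightarrow> 'a set" where
  "md_iterates f g N T \<delta>1 B c x1 = {iter s k | k s. md_reaches f g N T \<delta>1 B c x1 k s}"

end

theory Submission
  imports Defs
begin

text \<open>A mirror descent step from \<open>x\<close> to \<open>z\<close> with step size \<open>\<eta>\<close> satisfies, for every \<open>y\<close> in
  \<open>X \<inter> int dom h\<close>, the inequality
  \<open>D(y,z) \<le> D(y,x) - \<eta> (f x - f y) + \<eta>\<^sup>2 \<parallel>g x\<parallel>\<^sup>2 / 2\<close>. Suppose all iterates stay above \<open>f y + \<epsilon>\<close> for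
  such a \<open>y\<close>. If the level gap is halved infinitely often, the inequality makes \<open>\<Sum> \<eta>\<close> finite and
  \<open>D(y,x\<^sub>k)\<close> bounded. If it is eventually constant, sufficient decrease happens only finitely often since
  \<open>f\<close> is bounded below along the run, so the path length stays below \<open>B\<close>, and again \<open>D(y,x\<^sub>k)\<close> is bounded.
  Boundedness of \<open>D(y,x\<^sub>k)\<close> keeps the iterates in a compact subset of \<open>X \<inter> int dom h\<close>, because
  \<open>D(y,\<cdot>)\<close> blows up at the boundary of \<open>dom h\<close>; hence the subgradients are bounded. In the first case the total path
  length is then finite, so a path budget of \<open>B\<close> is exceeded only finitely often; in the second case the steps
  are bounded away from 0 and the path length is infinite. Both are absurd.\<close>

subsection \<open>Norms and convex functions\<close>

lemma is_norm_zero: "is_norm N \<Longrightarrow> N 0 = 0"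
  by (simp add: is_norm_def)

text \<open>Equivalence of norms, in one direction: \<open>N\<close> is Lipschitz, so it attains its
  minimum on the unit sphere, which is positive by definiteness; homogeneity carries the bound to
  all vectors.\<close>

lemma is_norm_lower_bound:
  fixes N :: "'a::euclidean_space \<Rightarrow> real"
  assumes "is_norm N"
  obtains m where "m > 0" "\<And>x. m * norm x \<le> N x"
proof -
  have nn: "N x \<ge> 0" and z: "N x = 0 \<longleftrightarrow> x = 0" and sc: "N (a *\<^sub>R x) = \<bar>a\<bar> * N x"
    and tri: "N (x + y) \<le> N x + N y" for a x y
    using assms by (auto simp: is_norm_def)
  have sum_le: "N (sum u S) \<le> (\<Sum>b\<in>S. N (u b))" if "finite S" for u :: "'a \<Rightarrow> 'a" and S
    using that
  proof (induction S)
    case empty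
    then show ?case using z[of 0] by simp
  next
    case (insert b S)
    then show ?case using tri[of "u b" "sum u S"] by auto
  qed
  define L where "L = (\<Sum>b\<in>Basis. N (b::'a))"
  have L: "N x \<le> L * norm x" for x
  proof -
    have "N x = N (\<Sum>b\<in>Basis. (x \<bullet> b) *\<^sub>R b)" by (simp add: euclidean_representation)
    also have "\<dots> \<le> (\<Sum>b\<in>Basis. \<bar>x \<bullet> b\<bar> * N b)"
      using sum_le[of Basis "\<lambda>b. (x \<bullet> b) *\<^sub>R b"] by (simp add: sc)
    also have "\<dots> \<le> (\<Sum>b\<in>Basis. norm x * N b)"
      by (intro sum_mono mult_right_mono Basis_le_norm nn)
    finally show ?thesis by (simp add: L_def sum_distrib_left mult.commute)
  qed
  have "L \<ge> 0" by (simp add: L_def sum_nonneg nn)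
  have diff: "N x - N y \<le> L * norm (x - y)" for x y
    using tri[of "x - y" y] L[of "x - y"] by simp
  have "L-lipschitz_on UNIV N"
  proof (rule lipschitz_onI)
    fix x y
    show "dist (N x) (N y) \<le> L * dist x y"
      using diff[of x y] diff[of y x] by (simp add: dist_real_def dist_norm norm_minus_commute)
  qed (rule \<open>L \<ge> 0\<close>)
  then have cont: "continuous_on (sphere 0 1) N"
    using lipschitz_on_continuous_on continuous_on_subset by blast
  obtain b :: 'a where "b \<in> Basis" using nonempty_Basis by blast
  then have "sphere (0::'a) 1 \<noteq> {}" by (metis norm_Basis mem_sphere_0 empty_iff)
  then obtain u where u: "u \<in> sphere 0 1" "\<And>x. x \<in> sphere 0 1 \<Longrightarrow> N u \<le> N x"
    using continuous_attains_inf[OF compact_sphere _ cont] by blast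
  show thesis
  proof
    show "N u > 0" using u(1) nn[of u] z[of u] by fastforce
    fix x
    show "N u * norm x \<le> N x"
    proof (cases "x = 0")
      case False
      then have "N u \<le> N ((1 / norm x) *\<^sub>R x)" by (intro u) simp
      then show ?thesis using False by (simp add: sc field_simps)
    qed (use nn in simp)
  qed
qed

text \<open>Bounds the set whose supremum is \<open>dual_norm N z\<close>; a real supremum carries
  information only for bounded sets.\<close>

lemma inner_le_norm_divide:
  fixes N :: "'a::euclidean_space \<Rightarrow> real"
  assumes "m > 0" "\<And>x. m * norm x \<le> N x" "N x \<le> 1"
  shows "z \<bullet> x \<le> norm z / m"
proof -
  have "norm x \<le> 1 / m" using assms(1) assms(2)[of x] assms(3) by (simp add: field_simps)
  then have "norm z * norm x \<le> norm z * (1 / m)" by (intro mult_left_mono) auto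
  then show ?thesis using norm_cauchy_schwarz[of z x] by simp
qed

text \<open>The unit ball of \<open>N\<close> lies in the Euclidean ball of radius 1/m. This later
  turns Euclidean bounds on subgradients into dual ones.\<close>

lemma dual_norm_upper_bound:
  fixes N :: "'a::euclidean_space \<Rightarrow> real"
  assumes "is_norm N"
  obtains L where "\<And>z. dual_norm N z \<le> L * norm z"
proof -
  obtain m where m: "m > 0" "\<And>x. m * norm x \<le> N x" using is_norm_lower_bound[OF assms] by blast
  have "0 \<in> {x. N x \<le> 1}" using is_norm_zero[OF assms] by simp
  then have "dual_norm N z \<le> 1 / m * norm z" for z
    unfolding dual_norm_def using inner_le_norm_divide[OF m] by (intro cSUP_least) auto
  then show thesis by (rule that)
qed

text \<open>Hoelder's inequality, obtained by scaling \<open>x\<close> to the unit sphere of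
  \<open>N\<close>.\<close>

lemma dual_norm_inner:
  fixes N :: "'a::euclidean_space \<Rightarrow> real"
  assumes "is_norm N"
  shows "z \<bullet> x \<le> dual_norm N z * N x"
proof (cases "x = 0")
  case True
  then show ?thesis using is_norm_zero[OF assms] by simp
next
  case False
  obtain m where m: "m > 0" "\<And>x. m * norm x \<le> N x" using is_norm_lower_bound[OF assms] by blast
  have pos: "N x > 0" using assms False by (simp add: is_norm_def less_le)
  have "N ((1 / N x) *\<^sub>R x) = \<bar>1 / N x\<bar> * N x" using assms by (simp only: is_norm_def)
  then have "N ((1 / N x) *\<^sub>R x) \<le> 1" using pos by simp
  moreover have "bdd_above ((\<bullet>) z ` {x. N x \<le> 1})"
    using inner_le_norm_divide[OF m] by (intro bdd_aboveI2[of _ _ "norm z / m"]) auto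
  ultimately have "z \<bullet> ((1 / N x) *\<^sub>R x) \<le> dual_norm N z"
    unfolding dual_norm_def by (intro cSUP_upper) auto
  then show ?thesis using pos by (simp add: field_simps)
qed

lemma dual_norm_pos:
  fixes N :: "'a::euclidean_space \<Rightarrow> real"
  assumes "is_norm N" "z \<noteq> 0"
  shows "dual_norm N z > 0"
proof -
  have "N z > 0" using assms by (simp add: is_norm_def less_le)
  moreover have "0 < dual_norm N z * N z"
    using dual_norm_inner[OF assms(1), of z z] assms(2) by (metis inner_gt_zero_iff less_le_trans)
  ultimately show ?thesis by (simp add: zero_less_mult_iff)
qed

section \<open>Convexity on the effective domain and gradients\<close>

lemma convex_fun_domain:
  assumes "proper_fun f" "convex_fun f"
  shows "convex (effective_domain f)"
    and "convex_on (effective_domain f) (\<lambda>x. real_of_ereal (f x))"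
    and "x \<in> effective_domain f \<Longrightarrow> f x = ereal (real_of_ereal (f x))"
proof -
  have fin: "f x = ereal (real_of_ereal (f x))" if "x \<in> effective_domain f" for x
    using assms(1) that by (cases "f x") (auto simp: proper_fun_def effective_domain_def)
  then show "x \<in> effective_domain f \<Longrightarrow> f x = ereal (real_of_ereal (f x))" .
  have comb: "f (u *\<^sub>R x + v *\<^sub>R y) \<le> ereal (u * real_of_ereal (f x) + v * real_of_ereal (f y))"
    if "x \<in> effective_domain f" "y \<in> effective_domain f" "u \<ge> 0" "v \<ge> 0" "u + v = 1" for x y u v
  proof -
    have "(x, real_of_ereal (f x)) \<in> ereal_epigraph f" "(y, real_of_ereal (f y)) \<in> ereal_epigraph f"
      using fin[OF that(1)] fin[OF that(2)] by (auto simp: ereal_epigraph_def)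
    then have "u *\<^sub>R (x, real_of_ereal (f x)) + v *\<^sub>R (y, real_of_ereal (f y)) \<in> ereal_epigraph f"
      using assms(2) that unfolding convex_fun_def by (intro convexD)
    then show ?thesis by (simp add: ereal_epigraph_def)
  qed
  then have mem: "u *\<^sub>R x + v *\<^sub>R y \<in> effective_domain f"
    if "x \<in> effective_domain f" "y \<in> effective_domain f" "u \<ge> 0" "v \<ge> 0" "u + v = 1" for x y u v
    using that by (fastforce simp: effective_domain_def)
  show conv: "convex (effective_domain f)"
    using mem by (auto simp: convex_def)
  show "convex_on (effective_domain f) (\<lambda>x. real_of_ereal (f x))"
    unfolding convex_on_def
  proof (intro conjI conv ballI allI impI)
    fix x y and u v :: real
    assume *: "x \<in> effective_domain f" "y \<in> effective_domain f" "0 \<le> u" "0 \<le> v" "u + v = 1"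
    show "real_of_ereal (f (u *\<^sub>R x + v *\<^sub>R y)) \<le> u * real_of_ereal (f x) + v * real_of_ereal (f y)"
      using comb[OF *] fin[OF mem[OF *]] by (metis ereal_less_eq(3))
  qed
qed

lemma GDERIV_unique:
  assumes "GDERIV F x :> v" "GDERIV F x :> w"
  shows "v = w"
proof -
  have "(\<lambda>h. h \<bullet> v) = (\<lambda>h. h \<bullet> w)"
    using assms has_derivative_unique unfolding gderiv_def by blast
  then have "\<forall>h. h \<bullet> v = h \<bullet> w" by (simp add: fun_eq_iff)
  then show ?thesis by (simp only: vector_eq_ldot)
qed

lemma grad_eqI: "GDERIV (\<lambda>y. real_of_ereal (h y)) x :> v \<Longrightarrow> grad h x = v"
  unfolding grad_def by (blast intro: GDERIV_unique)

text \<open>The Riesz representative of a linear functional is its adjoint applied to 1.\<close>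

lemma differentiable_imp_GDERIV:
  fixes F :: "'a::euclidean_space \<Rightarrow> real"
  assumes "F differentiable (at x)"
  obtains v where "GDERIV F x :> v"
proof -
  obtain D where D: "(F has_derivative D) (at x)" using assms by (auto simp: differentiable_def)
  then have "linear D" by (simp add: has_derivative_linear)
  then have "D = (\<lambda>h. h \<bullet> adjoint D 1)"
    by (simp add: fun_eq_iff adjoint_works)
  with D have "GDERIV F x :> adjoint D 1" by (simp add: gderiv_def)
  then show thesis by (rule that)
qed

text \<open>The limit is one-sided because the convexity and minimality estimates it is compared
  with hold only for small positive \<open>t\<close>.\<close>

lemma GDERIV_line:
  assumes "GDERIV F x :> v"
  shows "((\<lambda>t. (F (x + t *\<^sub>R w) - F x) / t) \<longlongrightarrow> v \<bullet> w) (at_right 0)"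
proof -
  have 1: "((\<lambda>t::real. x + t *\<^sub>R w) has_derivative (\<lambda>t. t *\<^sub>R w)) (at 0)"
    by (auto intro!: derivative_eq_intros)
  have "(F has_derivative (\<lambda>h. h \<bullet> v)) (at (x + 0 *\<^sub>R w))" using assms by (simp add: gderiv_def)
  from has_derivative_compose[OF 1 this]
  have "((\<lambda>t. F (x + t *\<^sub>R w)) has_derivative (\<lambda>t. t *\<^sub>R w \<bullet> v)) (at 0)" .
  then have "((\<lambda>t. F (x + t *\<^sub>R w)) has_field_derivative (v \<bullet> w)) (at 0)"
    by (simp add: has_field_derivative_def inner_commute mult_commute_abs)
  then have "((\<lambda>t. (F (x + t *\<^sub>R w) - F x) / t) \<longlongrightarrow> v \<bullet> w) (at 0)"
    by (simp add: DERIV_def)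
  then show ?thesis by (simp add: filterlim_at_split)
qed

text \<open>Convexity bounds the difference quotients towards \<open>y\<close> by
  \<open>F y - F x\<close>; the bound passes to the limit.\<close>

lemma convex_on_GDERIV_above:
  fixes F :: "'a::euclidean_space \<Rightarrow> real"
  assumes "convex_on S F" "x \<in> S" "y \<in> S" "GDERIV F x :> v"
  shows "F x + v \<bullet> (y - x) \<le> F y"
proof -
  have "eventually (\<lambda>t::real. 0 < t \<and> t < 1) (at_right 0)"
    using eventually_at_right_real[of 0 "1::real"] by simp
  then have "eventually (\<lambda>t. (F (x + t *\<^sub>R (y - x)) - F x) / t \<le> F y - F x) (at_right 0)"
  proof eventually_elim
    case (elim t)
    have "F ((1 - t) *\<^sub>R x + t *\<^sub>R y) \<le> (1 - t) * F x + t * F y"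
      using assms elim unfolding convex_on_def by simp
    moreover have "(1 - t) *\<^sub>R x + t *\<^sub>R y = x + t *\<^sub>R (y - x)" by (simp add: algebra_simps)
    ultimately show ?case using elim by (simp add: field_simps)
  qed
  from tendsto_upperbound[OF GDERIV_line[OF assms(4)] this] show ?thesis by simp
qed

subsection \<open>The mirror descent step\<close>

lemma convex_on_GDERIV_inner_le:
  fixes F :: "'a::euclidean_space \<Rightarrow> real"
  assumes "convex_on S F" "z \<in> S" "GDERIV F z :> v" "cball x r \<subseteq> S"
    "\<And>u. u \<in> cball x r \<Longrightarrow> F u \<le> M" "r > 0"
  shows "F z + v \<bullet> (x - z) + r * norm v \<le> M"
proof -
  \<comment> \<open>The gradient inequality is tested at the point of the ball farthest in direction
    \<open>v\<close>, which gains \<open>r * norm v\<close>. Since \<open>sgn 0 = 0\<close>, the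
    case \<open>v = 0\<close> is included.\<close>
  define u where "u = x + r *\<^sub>R sgn v"
  have "u \<in> cball x r" using assms(6) by (simp add: u_def dist_norm norm_sgn)
  then have "F z + v \<bullet> (u - z) \<le> M"
    using convex_on_GDERIV_above[OF assms(1,2) _ assms(3), of u] assms(4,5) by force
  moreover have "v \<bullet> sgn v = norm v"
    by (cases "v = 0") (simp_all add: sgn_div_norm power2_norm_eq_inner[symmetric] power2_eq_square)
  ultimately show ?thesis by (simp add: u_def inner_add_right inner_diff_right)
qed

section \<open>The Bregman divergence of a Legendre function\<close>

locale legendre_mirror =
  fixes h :: "'a::euclidean_space \<Rightarrow> ereal" and X :: "'a set" and N :: "'a \<Rightarrow> real"
  assumes legendre: "legendre_fun h"
    and closed_X: "closed X" and convex_X: "convex X"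
    and norm_N: "is_norm N"
    and strong: "\<And>x y. x \<in> X \<inter> interior (effective_domain h) \<Longrightarrow>
        y \<in> X \<inter> interior (effective_domain h) \<Longrightarrow> bregman h x y \<ge> ereal (1 / 2 * (N (y - x))\<^sup>2)"
begin

abbreviation dom where "dom \<equiv> effective_domain h"

text \<open>A real-valued copy of \<open>h\<close>. Off \<open>dom\<close> it has the default value
  0, so \<open>breg y x\<close> below has its intended meaning only for \<open>y\<close> in
  \<open>dom\<close> and \<open>x\<close> in the interior.\<close>

definition H :: "'a \<Rightarrow> real" where "H x = real_of_ereal (h x)"

definition breg :: "'a \<Rightarrow> 'a \<Rightarrow> real" where "breg y x = H y - H x - grad h x \<bullet> (y - x)"

lemma convex_dom: "convex dom"
  and convex_H: "convex_on dom H"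
  and h_eq: "x \<in> dom \<Longrightarrow> h x = ereal (H x)"
  using convex_fun_domain[of h] legendre unfolding legendre_fun_def H_def by auto

lemma interior_dom: "x \<in> interior dom \<Longrightarrow> x \<in> dom"
  using interior_subset by blast

lemma gderiv_H:
  assumes "x \<in> interior dom" shows "GDERIV H x :> grad h x"
proof -
  have "H differentiable (at x)"
    using assms legendre unfolding legendre_fun_def essentially_smooth_def H_def[abs_def] by blast
  then obtain v where "GDERIV H x :> v" by (rule differentiable_imp_GDERIV)
  then show ?thesis using grad_eqI[of h x v] unfolding H_def[abs_def] by simp
qed

lemma H_above: "x \<in> interior dom \<Longrightarrow> y \<in> dom \<Longrightarrow> H x + grad h x \<bullet> (y - x) \<le> H y"
  using convex_on_GDERIV_above[OF convex_H _ _ gderiv_H] interior_dom by blast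

lemma bregman_eq: "x \<in> interior dom \<Longrightarrow> y \<in> dom \<Longrightarrow> bregman h y x = ereal (breg y x)"
  by (simp add: bregman_def breg_def h_eq interior_dom)

lemma bregman_outside: "x \<in> interior dom \<Longrightarrow> y \<notin> dom \<Longrightarrow> bregman h y x = \<infinity>"
  using h_eq[OF interior_dom[of x]] by (simp add: bregman_def effective_domain_def)

lemma N_minus: "N (x - y) = N (y - x)"
proof -
  have "N ((-1) *\<^sub>R (y - x)) = \<bar>-1\<bar> * N (y - x)" using norm_N by (simp only: is_norm_def)
  then show ?thesis by simp
qed

lemma N_scale: "N (t *\<^sub>R x) = \<bar>t\<bar> * N x"
  using norm_N by (simp add: is_norm_def)

lemma shrink:
  assumes "x \<in> interior dom" "y \<in> closure dom" "0 < t" "t \<le> 1"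
  shows "y + t *\<^sub>R (x - y) \<in> interior dom"
  using mem_interior_closure_convex_shrink[OF convex_dom assms(1) assms(2) assms(3,4)]
  by (simp add: algebra_simps)

lemma convex_X_line: "x \<in> X \<Longrightarrow> y \<in> X \<Longrightarrow> 0 \<le> t \<Longrightarrow> t \<le> 1 \<Longrightarrow> y + t *\<^sub>R (x - y) \<in> X"
  using convexD_alt[OF convex_X, of y x t] by (simp add: algebra_simps)

text \<open>The hypothesis of strong convexity covers only pairs of interior points; one of the points may be
  moved to the boundary along the segment that joins them.\<close>

lemma breg_strong:
  assumes x: "x \<in> X" "x \<in> interior dom" and y: "y \<in> X" "y \<in> dom"
  shows "breg y x \<ge> (N (y - x))\<^sup>2 / 2"
proof -
  \<comment> \<open>\<open>breg\<close> is convex in its first argument and vanishes at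
    \<open>x\<close>, so moving \<open>y\<close> by the fraction s towards \<open>x\<close> scales
    it by at most 1 - s, while the square scales by exactly (1 - s)^2. One factor cancels; then s
    tends to 0.\<close>
  have "(1 - s) * ((N (y - x))\<^sup>2 / 2) \<le> breg y x" if s: "0 < s" "s < 1" for s
  proof -
    define t where "t = 1 - s"
    have t: "0 < t" "t < 1" using s by (auto simp: t_def)
    define z where "z = y + s *\<^sub>R (x - y)"
    have zx: "z - x = t *\<^sub>R (y - x)" by (simp add: z_def t_def algebra_simps)
    have z: "z \<in> interior dom" "z \<in> X"
      using shrink[OF x(2) subsetD[OF closure_subset y(2)], of s] convex_X_line[OF x(1) y(1), of s] s
      by (auto simp: z_def)
    have "t\<^sup>2 * ((N (y - x))\<^sup>2 / 2) = (N (z - x))\<^sup>2 / 2"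
      by (simp add: zx N_scale power_mult_distrib)
    also have "\<dots> \<le> breg z x"
      using strong[of z x] x z by (simp add: bregman_eq interior_dom N_minus[of x z])
    also have "\<dots> = H z - H x - t * (grad h x \<bullet> (y - x))" by (simp add: breg_def zx)
    also have "H z = H (t *\<^sub>R y + s *\<^sub>R x)" by (simp add: z_def t_def algebra_simps)
    also have "\<dots> \<le> t * H y + s * H x"
      using convex_H y(2) interior_dom[OF x(2)] t s unfolding convex_on_def by (simp add: t_def)
    also have "t * H y + s * H x - H x - t * (grad h x \<bullet> (y - x)) = t * breg y x"
      by (simp add: breg_def t_def algebra_simps)
    finally have "t\<^sup>2 * ((N (y - x))\<^sup>2 / 2) \<le> t * breg y x" by simp
    then have "t * (t * ((N (y - x))\<^sup>2 / 2)) \<le> t * breg y x"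
      by (simp only: power2_eq_square[of t] mult.assoc)
    then have "t * ((N (y - x))\<^sup>2 / 2) \<le> breg y x"
      using t(1) by (simp only: mult_le_cancel_left_pos)
    then show ?thesis by (simp only: t_def)
  qed
  then have "eventually (\<lambda>s. (1 - s) * ((N (y - x))\<^sup>2 / 2) \<le> breg y x) (at_right 0)"
    using eventually_at_right_real[of 0 "1::real"] by (auto elim: eventually_mono)
  moreover have "((\<lambda>s. (1 - s) * ((N (y - x))\<^sup>2 / 2)) \<longlongrightarrow> (1 - 0) * ((N (y - x))\<^sup>2 / 2)) (at_right 0)"
    by (intro tendsto_intros)
  ultimately have "(1 - 0) * ((N (y - x))\<^sup>2 / 2) \<le> breg y x"
    by (intro tendsto_upperbound[of _ _ "at_right (0::real)"]) auto
  then show ?thesis by simp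
qed

lemma breg_nonneg:
  assumes "x \<in> X" "x \<in> interior dom" "y \<in> X" "y \<in> dom"
  shows "breg y x \<ge> 0"
  by (rule order_trans[OF _ breg_strong[OF assms]]) simp

text \<open>A gradient at \<open>z\<close> of large norm must point strongly away from the fixed
  interior point \<open>x\<close>. \<open>M\<close> is the maximum of \<open>H\<close> on a ball
  around \<open>x\<close>, hence independent of \<open>z\<close>.\<close>

lemma repulsion:
  assumes "x \<in> interior dom"
  obtains r M where "r > 0" "\<And>z. z \<in> interior dom \<Longrightarrow> H z + grad h z \<bullet> (x - z) + r * norm (grad h z) \<le> M"
proof -
  obtain r where r: "r > 0" "cball x r \<subseteq> interior dom"
    using open_contains_cball[of "interior dom"] assms by auto
  have "continuous_on (cball x r) H"
    using r(2) gderiv_H unfolding gderiv_def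
    by (meson continuous_at_imp_continuous_on has_derivative_continuous subsetD)
  then obtain u where u: "u \<in> cball x r" "\<And>z. z \<in> cball x r \<Longrightarrow> H z \<le> H u"
    using continuous_attains_sup[of "cball x r" H] r(1) by fastforce
  show thesis
  proof
    show "r > 0" by (rule r)
    fix z assume "z \<in> interior dom"
    then show "H z + grad h z \<bullet> (x - z) + r * norm (grad h z) \<le> H u"
      using r u interior_subset
      by (intro convex_on_GDERIV_inner_le[OF convex_H interior_dom gderiv_H]) auto
  qed
qed

lemma frontier_grad_at_top:
  assumes "\<And>n::nat. u n \<in> interior dom" "u \<longlonglongrightarrow> z" "z \<in> closure dom" "z \<notin> interior dom"
  shows "filterlim (\<lambda>n. norm (grad h (u n))) at_top sequentially"
  using assms legendre unfolding legendre_fun_def essentially_smooth_def frontier_def by auto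

text \<open>Essential smoothness makes the gradients blow up near the boundary, and
  \<open>repulsion\<close> converts this into growth of \<open>breg y\<close>.\<close>

lemma breg_frontier_unbounded:
  assumes y: "y \<in> interior dom" and u: "\<And>n::nat. u n \<in> interior dom" and b: "\<And>n. breg y (u n) \<le> C"
    and lim: "u \<longlonglongrightarrow> z"
  shows "z \<in> interior dom"
proof (rule ccontr)
  assume "z \<notin> interior dom"
  moreover have "z \<in> closure dom"
    using u lim closure_sequential interior_dom by blast
  ultimately have top: "filterlim (\<lambda>n. norm (grad h (u n))) at_top sequentially"
    using frontier_grad_at_top[OF u lim] by blast
  obtain r M where r: "r > 0" and M: "\<And>z. z \<in> interior dom \<Longrightarrow> H z + grad h z \<bullet> (y - z) + r * norm (grad h z) \<le> M"
    using repulsion[OF y] by blast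
  \<comment> \<open>The sum of value and slope towards \<open>y\<close> in \<open>M\<close> equals
    \<open>H y - breg y (u n)\<close>, which is at least \<open>H y - C\<close>.\<close>
  have "norm (grad h (u n)) \<le> (C + M - H y) / r" for n
    using M[OF u[of n]] b[of n] r by (simp add: breg_def field_simps)
  moreover obtain n where "norm (grad h (u n)) \<ge> (C + M - H y) / r + 1"
    using top unfolding filterlim_at_top eventually_sequentially by blast
  ultimately show False by (smt (verit))
qed

text \<open>Strong convexity bounds the sequence, and \<open>breg_frontier_unbounded\<close> keeps
  its limit points off the boundary. The compact set obtained is the one on which the subgradients
  are bounded.\<close>

lemma breg_bounded_compact:
  assumes y: "y \<in> X" "y \<in> interior dom"
    and u: "\<And>n::nat. u n \<in> X" "\<And>n. u n \<in> interior dom" and b: "\<And>n. breg y (u n) \<le> C"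
  shows "compact (closure (range u))" "closure (range u) \<subseteq> X \<inter> interior dom"
proof -
  obtain m where m: "m > 0" "\<And>x. m * norm x \<le> N x" using is_norm_lower_bound[OF norm_N] by blast
  have "norm (u n - y) \<le> sqrt (2 * C) / m" for n
  proof -
    have "(N (y - u n))\<^sup>2 \<le> 2 * C"
      using breg_strong[OF u(1,2) y(1) interior_dom[OF y(2)], of n] b[of n] by simp
    then have "N (y - u n) \<le> sqrt (2 * C)" by (rule real_le_rsqrt)
    then show ?thesis using m(1) m(2)[of "y - u n"]
      by (simp add: field_simps norm_minus_commute)
  qed
  then have "range u \<subseteq> cball y (sqrt (2 * C) / m)"
    by (auto simp: dist_norm norm_minus_commute)
  then have "bounded (range u)" using bounded_cball bounded_subset by blast
  then show "compact (closure (range u))" by simp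
  show "closure (range u) \<subseteq> X \<inter> interior dom"
  proof
    fix z assume "z \<in> closure (range u)"
    then obtain w where w: "\<And>n::nat. w n \<in> range u" "w \<longlonglongrightarrow> z" using closure_sequential by blast
    have "z \<in> X" using closed_sequentially[OF closed_X _ w(2)] w(1) u(1) by (metis rangeE)
    moreover have "z \<in> interior dom"
    proof (rule breg_frontier_unbounded[OF y(2) _ _ w(2)])
      fix n
      show "w n \<in> interior dom" "breg y (w n) \<le> C" using w(1)[of n] u(2) b by auto
    qed
    ultimately show "z \<in> X \<inter> interior dom" by blast
  qed
qed

section \<open>Existence, location and optimality of the mirror step\<close>

definition obj :: "'a \<Rightarrow> 'a \<Rightarrow> real \<Rightarrow> 'a \<Rightarrow> ereal" where
  "obj a x \<eta> y = ereal (a \<bullet> (y - x)) + bregman h y x / ereal \<eta>"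

lemma obj_eq:
  assumes "x \<in> interior dom" "\<eta> > 0"
  shows "y \<in> dom \<Longrightarrow> obj a x \<eta> y = ereal (a \<bullet> (y - x) + breg y x / \<eta>)"
    and "y \<notin> dom \<Longrightarrow> obj a x \<eta> y = \<infinity>"
  using assms by (auto simp: obj_def bregman_eq bregman_outside)

text \<open>Minimizing over the epigraph makes the objective the continuous function
  \<open>\<psi>\<close>, and closedness of \<open>h\<close> is closedness of the epigraph. Strong
  convexity makes the sublevel set \<open>E\<close> compact.\<close>

lemma mirror_minimizer_exists:
  assumes x: "x \<in> X" "x \<in> interior dom" and \<eta>: "\<eta> > 0"
  shows "\<exists>z. is_arg_min (obj a x \<eta>) (\<lambda>y. y \<in> X) z"
proof -
  define v where "v = grad h x"
  obtain m where m: "m > 0" "\<And>x. m * norm x \<le> N x" using is_norm_lower_bound[OF norm_N] by blast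
  define \<psi> where "\<psi> = (\<lambda>(y, r). a \<bullet> (y - x) + (r - H x - v \<bullet> (y - x)) / \<eta>)"
  \<comment> \<open>The level 0 is the value of the objective at \<open>x\<close> itself, so
    \<open>E\<close> is nonempty.\<close>
  define E where "E = ereal_epigraph h \<inter> (X \<times> UNIV) \<inter> {p. \<psi> p \<le> 0}"
  have cont: "continuous_on A \<psi>" for A
    unfolding \<psi>_def case_prod_unfold by (intro continuous_intros) (use \<eta> in auto)
  have "closed (ereal_epigraph h)" using legendre by (simp add: legendre_fun_def closed_fun_def)
  then have closed: "closed E"
    unfolding E_def by (intro closed_Int closed_Times closed_X closed_Collect_le cont continuous_intros) auto
  \<comment> \<open>The growth m^2 norm(y - x)^2 / 2 cannot exceed the linear term \<eta> norm(a)
    norm(y - x); solving for norm(y - x) gives this radius.\<close>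
  define \<rho> where "\<rho> = 2 * \<eta> * norm a / m\<^sup>2"
  have E: "y \<in> X \<and> y \<in> dom \<and> H y \<le> r \<and> norm (y - x) \<le> \<rho> \<and>
      \<bar>r - H x\<bar> \<le> norm v * \<rho> + \<eta> * norm a * \<rho>" if "(y, r) \<in> E" for y r
  proof -
    have yX: "y \<in> X" and hr: "h y \<le> ereal r" and le: "a \<bullet> (y - x) + (r - H x - v \<bullet> (y - x)) / \<eta> \<le> 0"
      using that by (auto simp: E_def \<psi>_def ereal_epigraph_def)
    have yD: "y \<in> dom" using hr by (auto simp: effective_domain_def)
    have Hr: "H y \<le> r" using hr h_eq[OF yD] by simp
    have strong: "(N (y - x))\<^sup>2 / 2 \<le> r - H x - v \<bullet> (y - x)"
      using breg_strong[OF x yX yD] Hr by (simp add: breg_def v_def)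
    have le': "r - H x - v \<bullet> (y - x) \<le> \<eta> * (- (a \<bullet> (y - x)))"
      using le \<eta> by (simp add: field_simps)
    have cs: "- (a \<bullet> (y - x)) \<le> norm a * norm (y - x)"
      using norm_cauchy_schwarz[of "- a" "y - x"] by simp
    then have up: "r - H x - v \<bullet> (y - x) \<le> \<eta> * (norm a * norm (y - x))"
      using le' \<eta> by (meson mult_left_mono less_imp_le order_trans)
    have "(m * norm (y - x))\<^sup>2 \<le> (N (y - x))\<^sup>2" using m by (intro power_mono) auto
    then have "norm (y - x) * (m\<^sup>2 * norm (y - x)) \<le> norm (y - x) * (2 * \<eta> * norm a)"
      using strong up by (simp add: power2_eq_square algebra_simps)
    then have "m\<^sup>2 * norm (y - x) \<le> 2 * \<eta> * norm a \<or> norm (y - x) = 0"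
      by (metis mult_le_cancel_left_pos norm_ge_zero order_le_less)
    then have \<rho>: "norm (y - x) \<le> \<rho>"
      using m(1) \<eta> by (auto simp: \<rho>_def field_simps)
    have "\<bar>v \<bullet> (y - x)\<bar> \<le> norm v * norm (y - x)" by (rule Cauchy_Schwarz_ineq2)
    also have "\<dots> \<le> norm v * \<rho>" using \<rho> by (intro mult_left_mono) auto
    finally have 1: "\<bar>v \<bullet> (y - x)\<bar> \<le> norm v * \<rho>" .
    have "\<eta> * (norm a * norm (y - x)) \<le> \<eta> * (norm a * \<rho>)" using \<rho> \<eta> by (intro mult_left_mono) auto
    moreover have "0 \<le> r - H x - v \<bullet> (y - x)" using strong zero_le_power2[of "N (y - x)"] by linarith
    ultimately have "\<bar>r - H x\<bar> \<le> norm v * \<rho> + \<eta> * norm a * \<rho>"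
      using 1 up by (simp add: mult.assoc)
    with yX yD Hr \<rho> show ?thesis by blast
  qed
  have "E \<subseteq> cball x \<rho> \<times> cball (H x) (norm v * \<rho> + \<eta> * norm a * \<rho>)"
  proof
    fix p assume "p \<in> E"
    moreover obtain y r where "p = (y, r)" by (cases p)
    ultimately show "p \<in> cball x \<rho> \<times> cball (H x) (norm v * \<rho> + \<eta> * norm a * \<rho>)"
      using E[of y r] by (simp add: dist_norm norm_minus_commute abs_minus_commute)
  qed
  then have "bounded E" using bounded_Times bounded_cball bounded_subset by blast
  with closed have "compact E" by (simp add: compact_eq_bounded_closed)
  have xE: "(x, H x) \<in> E"
    using x h_eq[OF interior_dom[OF x(2)]] by (simp add: E_def \<psi>_def ereal_epigraph_def)
  obtain p where p: "p \<in> E" "\<And>q. q \<in> E \<Longrightarrow> \<psi> p \<le> \<psi> q"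
    using continuous_attains_inf[OF \<open>compact E\<close> _ cont] xE by blast
  obtain z r where zr: "p = (z, r)" by (cases p)
  have z: "z \<in> X" "z \<in> dom" "H z \<le> r" using E[of z r] p(1) zr by auto
  \<comment> \<open>The minimizing pair may lie strictly above the graph, but lowering
    \<open>r\<close> to \<open>H z\<close> only decreases the objective.\<close>
  have obj_z: "obj a x \<eta> z \<le> ereal (\<psi> p)"
    using z \<eta> by (simp add: obj_eq[OF x(2) \<eta>] zr \<psi>_def breg_def v_def divide_right_mono)
  have "\<psi> p \<le> 0" using p(1) by (simp add: E_def)
  have "obj a x \<eta> z \<le> obj a x \<eta> y" if y: "y \<in> X" for y
  proof (cases "y \<in> dom")
    case True
    have eq: "obj a x \<eta> y = ereal (\<psi> (y, H y))"
      using True by (simp add: obj_eq[OF x(2) \<eta>] \<psi>_def breg_def v_def)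
    show ?thesis
    proof (cases "\<psi> (y, H y) \<le> 0")
      case True
      then have "(y, H y) \<in> E" using y h_eq[OF \<open>y \<in> dom\<close>] by (simp add: E_def ereal_epigraph_def)
      then show ?thesis using p(2) obj_z eq by (metis ereal_less_eq(3) order_trans)
    next
      case False
      then show ?thesis using \<open>\<psi> p \<le> 0\<close> obj_z eq
        by (metis ereal_less_eq(3) order_trans linear)
    qed
  qed (simp add: obj_eq[OF x(2) \<eta>])
  with z(1) show ?thesis by (force simp: is_arg_min_def not_less)
qed

text \<open>At a boundary point of the domain the slope of \<open>h\<close> towards an interior point is \<open>-\<infinity>\<close>, so such a
  point is never a minimizer.\<close>

lemma mirror_minimizer_interior:
  assumes x: "x \<in> X" "x \<in> interior dom" and \<eta>: "\<eta> > 0"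
    and z: "is_arg_min (obj a x \<eta>) (\<lambda>y. y \<in> X) z"
  shows "z \<in> X" "z \<in> interior dom"
proof -
  show zX: "z \<in> X" using z by (simp add: is_arg_min_def)
  have min: "obj a x \<eta> z \<le> obj a x \<eta> y" if "y \<in> X" for y
    using z that by (auto simp: is_arg_min_def not_less)
  have zD: "z \<in> dom"
    using min[OF x(1)] obj_eq[OF x(2) \<eta>] interior_dom[OF x(2)] by fastforce
  show "z \<in> interior dom"
  proof (rule ccontr)
    assume nz: "z \<notin> interior dom"
    define t where "t n = inverse (real (Suc (Suc n)))" for n
    have t: "0 < t n" "t n \<le> 1/2" for n by (auto simp: t_def field_simps)
    have t0: "t \<longlonglongrightarrow> 0"
      unfolding t_def by (rule LIMSEQ_Suc[OF LIMSEQ_inverse_real_of_nat])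
    define u where "u n = z + t n *\<^sub>R (x - z)" for n
    have u: "u n \<in> interior dom" "u n \<in> X" for n
      using shrink[OF x(2) subsetD[OF closure_subset zD], of "t n"] convex_X_line[OF x(1) zX, of "t n"] t[of n]
      by (auto simp: u_def)
    have "u \<longlonglongrightarrow> z + 0 *\<^sub>R (x - z)" unfolding u_def by (intro tendsto_intros t0)
    then have top: "filterlim (\<lambda>n. norm (grad h (u n))) at_top sequentially"
      using frontier_grad_at_top[of u z] u(1) closure_subset zD nz by auto
    obtain r M where r: "r > 0" and M: "\<And>z. z \<in> interior dom \<Longrightarrow> H z + grad h z \<bullet> (x - z) + r * norm (grad h z) \<le> M"
      using repulsion[OF x(2)] by blast
    define v where "v = grad h x"
    define K where "K = \<bar>v \<bullet> (x - z)\<bar> + \<eta> * \<bar>a \<bullet> (x - z)\<bar>"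
    \<comment> \<open>Minimality of \<open>z\<close> against \<open>u n\<close> bounds
      \<open>H (u n) - H z\<close> below by a multiple of \<open>t n\<close>; the gradient
      inequality at \<open>u n\<close> bounds it above by \<open>t n\<close> times the slope. The
      factor \<open>t n\<close> cancels.\<close>
    have slope: "grad h (u n) \<bullet> (x - z) \<ge> - K" for n
    proof -
      have "0 \<le> a \<bullet> (u n - z) + (breg (u n) x - breg z x) / \<eta>"
        using min[OF u(2)[of n]] zD interior_dom[OF u(1)[of n]]
        by (simp add: obj_eq[OF x(2) \<eta>] inner_diff_right diff_divide_distrib)
      then have "0 \<le> \<eta> * (a \<bullet> (u n - z)) + (breg (u n) x - breg z x)"
        using \<eta> by (simp add: field_simps)
      also have "breg (u n) x - breg z x = H (u n) - H z - v \<bullet> (u n - z)"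
        by (simp add: breg_def v_def inner_diff_right)
      also have "H (u n) - H z \<le> grad h (u n) \<bullet> (u n - z)"
        using H_above[OF u(1)[of n] zD] by (simp add: inner_diff_right)
      finally have "0 \<le> t n * (\<eta> * (a \<bullet> (x - z)) + grad h (u n) \<bullet> (x - z) - v \<bullet> (x - z))"
        by (simp add: u_def distrib_left right_diff_distrib mult.left_commute)
      then have "0 \<le> \<eta> * (a \<bullet> (x - z)) + grad h (u n) \<bullet> (x - z) - v \<bullet> (x - z)"
        using t(1)[of n] by (simp add: zero_le_mult_iff)
      moreover have "\<eta> * (a \<bullet> (x - z)) \<le> \<eta> * \<bar>a \<bullet> (x - z)\<bar>" using \<eta> by (intro mult_left_mono) auto
      ultimately show ?thesis unfolding K_def by linarith
    qed
    \<comment> \<open>By \<open>repulsion\<close>, slopes towards \<open>x\<close> bounded below cap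
      the gradient norms, since the tangent at \<open>x\<close> bounds \<open>H (u n)\<close> below.
      This contradicts \<open>top\<close>.\<close>
    have "norm (grad h (u n)) \<le> (M + K + \<bar>H x\<bar> + norm v * norm (x - z)) / r" for n
    proof -
      have eq: "x - u n = (1 - t n) *\<^sub>R (x - z)" by (simp add: u_def algebra_simps)
      have "0 \<le> K" using \<eta> by (simp add: K_def)
      have "- K \<le> (1 - t n) * (- K)"
        using mult_right_mono[of "1 - t n" 1 K] t(1)[of n] \<open>0 \<le> K\<close> by simp
      also have "\<dots> \<le> (1 - t n) * (grad h (u n) \<bullet> (x - z))"
        using slope t(2)[of n] by (intro mult_left_mono) auto
      also have "\<dots> = grad h (u n) \<bullet> (x - u n)" by (simp add: eq)
      finally have 1: "- K \<le> grad h (u n) \<bullet> (x - u n)" .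
      have "norm (x - u n) \<le> norm (x - z)"
        using mult_right_mono[of "\<bar>1 - t n\<bar>" 1 "norm (x - z)"] t[of n] by (simp add: eq)
      then have "norm v * norm (x - u n) \<le> norm v * norm (x - z)" by (intro mult_left_mono) auto
      moreover have "v \<bullet> (x - u n) \<le> norm v * norm (x - u n)" by (rule norm_cauchy_schwarz)
      moreover have "H x + v \<bullet> (u n - x) \<le> H (u n)"
        using H_above[OF x(2) interior_dom[OF u(1)[of n]]] by (simp add: v_def)
      moreover have "v \<bullet> (u n - x) = - (v \<bullet> (x - u n))" by (simp add: inner_diff_right)
      ultimately have "- \<bar>H x\<bar> - norm v * norm (x - z) \<le> H (u n)" by linarith
      with 1 M[OF u(1)[of n]] have "r * norm (grad h (u n)) \<le> M + K + \<bar>H x\<bar> + norm v * norm (x - z)"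
        by linarith
      then show ?thesis using r by (simp add: field_simps)
    qed
    moreover obtain n where "norm (grad h (u n)) \<ge> (M + K + \<bar>H x\<bar> + norm v * norm (x - z)) / r + 1"
      using top unfolding filterlim_at_top eventually_sequentially by blast
    ultimately show False by (smt (verit))
  qed
qed

text \<open>The variational inequality of the step: the objective does not decrease from
  \<open>z\<close> towards \<open>y\<close>, and its one-sided derivative is available because
  \<open>z\<close> is interior.\<close>

lemma mirror_minimizer_optimality:
  assumes x: "x \<in> X" "x \<in> interior dom" and \<eta>: "\<eta> > 0"
    and z: "is_arg_min (obj a x \<eta>) (\<lambda>y. y \<in> X) z"
    and y: "y \<in> X" "y \<in> interior dom"
  shows "\<eta> * (a \<bullet> (z - y)) \<le> (grad h z - grad h x) \<bullet> (y - z)"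
proof -
  note zi = mirror_minimizer_interior[OF x \<eta> z]
  define v where "v = grad h x"
  have min: "obj a x \<eta> z \<le> obj a x \<eta> y" if "y \<in> X" for y
    using z that by (auto simp: is_arg_min_def not_less)
  have "eventually (\<lambda>t::real. 0 < t \<and> t < 1) (at_right 0)"
    using eventually_at_right_real[of 0 "1::real"] by simp
  then have "eventually (\<lambda>t. v \<bullet> (y - z) - \<eta> * (a \<bullet> (y - z)) \<le> (H (z + t *\<^sub>R (y - z)) - H z) / t) (at_right 0)"
  proof eventually_elim
    case (elim t)
    define w where "w = z + t *\<^sub>R (y - z)"
    have w: "w \<in> interior dom" "w \<in> X"
      using shrink[OF y(2) subsetD[OF closure_subset interior_dom[OF zi(2)]], of t]
        convex_X_line[OF y(1) zi(1), of t] elim by (auto simp: w_def)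
    have "0 \<le> a \<bullet> (w - z) + (breg w x - breg z x) / \<eta>"
      using min[OF w(2)] interior_dom[OF w(1)] interior_dom[OF zi(2)]
      by (simp add: obj_eq[OF x(2) \<eta>] inner_diff_right diff_divide_distrib)
    then have "0 \<le> \<eta> * (a \<bullet> (w - z)) + (breg w x - breg z x)"
      using \<eta> by (simp add: field_simps)
    also have "breg w x - breg z x = H w - H z - v \<bullet> (w - z)"
      by (simp add: breg_def v_def inner_diff_right)
    also have "w - z = t *\<^sub>R (y - z)" by (simp add: w_def)
    finally have "t * (v \<bullet> (y - z) - \<eta> * (a \<bullet> (y - z))) \<le> H w - H z"
      by (simp add: right_diff_distrib mult.left_commute)
    then show ?case unfolding w_def[symmetric] using elim by (simp add: pos_le_divide_eq mult.commute)
  qed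
  from tendsto_lowerbound[OF GDERIV_line[OF gderiv_H[OF zi(2)]] this]
  have "v \<bullet> (y - z) - \<eta> * (a \<bullet> (y - z)) \<le> grad h z \<bullet> (y - z)" by simp
  then show ?thesis by (simp add: v_def inner_diff_left inner_diff_right right_diff_distrib)
qed

lemma mirror_step_descent:
  assumes x: "x \<in> X" "x \<in> interior dom" and \<eta>: "\<eta> > 0"
    and z: "is_arg_min (obj a x \<eta>) (\<lambda>y. y \<in> X) z"
    and y: "y \<in> X" "y \<in> interior dom"
  shows "breg y z \<le> breg y x - \<eta> * (a \<bullet> (x - y)) + (\<eta> * dual_norm N a)\<^sup>2 / 2"
proof -
  note zi = mirror_minimizer_interior[OF x \<eta> z]
  \<comment> \<open>The three-point identity rewrites the right side of the variational
    inequality.\<close>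
  have "\<eta> * (a \<bullet> (z - y)) \<le> breg y x - breg y z - breg z x"
    using mirror_minimizer_optimality[OF x \<eta> z y]
    by (simp add: breg_def inner_diff_left inner_diff_right)
  moreover have "breg z x \<ge> (N (z - x))\<^sup>2 / 2"
    using breg_strong[OF x zi(1) interior_dom[OF zi(2)]] .
  moreover have "\<eta> * (a \<bullet> (x - z)) \<le> \<eta> * (dual_norm N a * N (z - x))"
    using dual_norm_inner[OF norm_N, of a "x - z"] \<eta> N_minus[of x z] by (intro mult_left_mono) auto
  \<comment> \<open>Young's inequality: the cross term from moving \<open>x\<close> to
    \<open>z\<close> is absorbed by the strong convexity of \<open>breg z x\<close>.\<close>
  moreover have "0 \<le> (\<eta> * dual_norm N a - N (z - x))\<^sup>2" by simp
  ultimately show ?thesis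
    by (simp add: power2_eq_square algebra_simps)
qed

end

subsection \<open>Level control\<close>

lemma eventually_bounded_imp_bounded:
  fixes u :: "nat \<Rightarrow> real"
  assumes "\<And>n. n \<ge> K \<Longrightarrow> u n \<le> C"
  shows "\<exists>C'. \<forall>n. u n \<le> C'"
proof (intro exI allI)
  fix n
  show "u n \<le> max C (Max (u ` {..K}))"
    using assms[of n] by (cases "n \<le> K") (simp_all add: le_max_iff_disj)
qed

text \<open>The scalar sequences behind the algorithm: \<open>F n\<close> is the objective value, \<open>R n\<close> the reference value,
  \<open>d n\<close> the level gap, \<open>p n\<close> the path length on entering iteration \<open>n\<close>, and \<open>E n\<close> is the Bregman distance from
  the iterate to a point with objective value \<open>\<alpha>\<close>.\<close>

locale level_control =
  fixes F R d p \<eta> G E :: "nat \<Rightarrow> real" and B c \<alpha> \<epsilon> :: real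
  assumes B: "B > 0" and c: "c > 1/2" and \<epsilon>: "\<epsilon> > 0" and d0: "d 0 > 0" and p0: "p 0 = 0"
    and R_reset: "\<And>n. F n \<le> R n - d n / 2 \<or> p n > B \<Longrightarrow> R (Suc n) \<le> F n"
    and R_keep: "\<And>n. \<not> (F n \<le> R n - d n / 2 \<or> p n > B) \<Longrightarrow> R (Suc n) = R n"
    and R_mono: "\<And>n. R (Suc n) \<le> R n"
    and R_lower: "\<And>n. \<alpha> + \<epsilon> \<le> R n"
    and d_halve: "\<And>n. \<not> F n \<le> R n - d n / 2 \<Longrightarrow> p n > B \<Longrightarrow> d (Suc n) = d n / 2"
    and d_keep: "\<And>n. F n \<le> R n - d n / 2 \<or> \<not> p n > B \<Longrightarrow> d (Suc n) = d n"
    and p_reset: "\<And>n. F n \<le> R n - d n / 2 \<or> p n > B \<Longrightarrow> p (Suc n) = c * \<eta> n * G n"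
    and p_keep: "\<And>n. \<not> (F n \<le> R n - d n / 2 \<or> p n > B) \<Longrightarrow> p (Suc n) = p n + c * \<eta> n * G n"
    and G: "\<And>n. G n > 0"
    and \<eta>: "\<And>n. \<eta> n = (F n - (R (Suc n) - d (Suc n))) / (c * (G n)\<^sup>2)"
    and E_nonneg: "\<And>n. E n \<ge> 0"
    and E_descent: "\<And>n. E (Suc n) \<le> E n - \<eta> n * (F n - \<alpha>) + (\<eta> n * G n)\<^sup>2 / 2"
    and F_lower: "\<And>n. \<alpha> + \<epsilon> \<le> F n"
    and G_bounded: "\<And>C. (\<And>n. E n \<le> C) \<Longrightarrow> \<exists>\<Gamma>. \<forall>n. G n \<le> \<Gamma>"
begin

lemma d_pos: "d n > 0"
proof (induction n)
  case (Suc n)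
  then show ?case using d_halve[of n] d_keep[of n] by fastforce
qed (rule d0)

lemma d_Suc_le: "d (Suc n) \<le> d n"
  using d_halve[of n] d_keep[of n] d_pos[of n] by fastforce

lemma d_antimono: "m \<le> n \<Longrightarrow> d n \<le> d m"
  using lift_Suc_antimono_le[of d] d_Suc_le by blast

lemma R_antimono: "m \<le> n \<Longrightarrow> R n \<le> R m"
  using lift_Suc_antimono_le[of R] R_mono by blast

text \<open>\<open>R (Suc n) - d (Suc n)\<close> is the target after the adjustment in step n. After
  a reset the reference is at most \<open>F n\<close>, leaving the full gap; otherwise the failed
  decrease test leaves more than half of it.\<close>

lemma gap: "F n - (R (Suc n) - d (Suc n)) \<ge> d (Suc n) / 2"
  using R_reset[of n] R_keep[of n] d_keep[of n] d_pos[of "Suc n"] by fastforce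

lemma gap_eq: "F n - (R (Suc n) - d (Suc n)) = c * \<eta> n * (G n)\<^sup>2"
  using \<eta>[of n] G[of n] c by simp

lemma \<eta>_pos: "\<eta> n > 0"
  using \<eta>[of n] gap[of n] d_pos[of "Suc n"] G[of n] c by simp

lemma q_pos: "c * \<eta> n * G n > 0"
  using \<eta>_pos[of n] G[of n] c by simp

lemma p_nonneg: "p n \<ge> 0"
proof (induction n)
  case (Suc n)
  then show ?case using p_reset[of n] p_keep[of n] q_pos[of n] by fastforce
qed (simp add: p0)

lemma p_Suc_le: "p (Suc n) \<le> p n + c * \<eta> n * G n"
  using p_reset[of n] p_keep[of n] p_nonneg[of n] by fastforce

text \<open>Once the level gap is small, the target value exceeds \<open>\<alpha>\<close> by a fixed amount.\<close>

lemma E_descent_small_gap: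
  assumes "d (Suc n) \<le> \<epsilon> / 2"
  shows "E (Suc n) \<le> E n - \<eta> n * (\<epsilon> / 2)"
proof -
  \<comment> \<open>\<open>F n - \<alpha>\<close> is split at the target, which lies at least
    \<epsilon> - d (Suc n) above \<alpha>.\<close>
  have "c * \<eta> n * (G n)\<^sup>2 + \<epsilon> / 2 \<le> F n - \<alpha>"
    using assms R_lower[of "Suc n"] gap_eq[of n] by linarith
  then have "\<eta> n * (c * \<eta> n * (G n)\<^sup>2 + \<epsilon> / 2) \<le> \<eta> n * (F n - \<alpha>)"
    using \<eta>_pos[of n] by (intro mult_left_mono) auto
  then have "c * (\<eta> n * G n)\<^sup>2 + \<eta> n * (\<epsilon> / 2) \<le> \<eta> n * (F n - \<alpha>)"
    by (simp add: power2_eq_square algebra_simps)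
  \<comment> \<open>Here c > 1/2 enters: the gain of the Polyak-type step covers its quadratic
    error.\<close>
  moreover have "(1/2) * (\<eta> n * G n)\<^sup>2 \<le> c * (\<eta> n * G n)\<^sup>2"
    using c by (intro mult_right_mono) auto
  ultimately show ?thesis using E_descent[of n] by linarith
qed

lemma E_ascent_le: "E (Suc n) \<le> E n + (\<eta> n * G n)\<^sup>2 / 2"
proof -
  have "0 \<le> \<eta> n * (F n - \<alpha>)" using \<eta>_pos[of n] F_lower[of n] \<epsilon> by simp
  then show ?thesis using E_descent[of n] by linarith
qed

section \<open>The two extreme patterns of resets\<close>

text \<open>Once the gap is at most \<epsilon>/2, the descent estimate telescopes: the step sizes
  are summable and \<open>E\<close> is bounded. Then \<open>G\<close> is bounded, the path
  increments are summable, and their Cauchy tails fall below \<open>B\<close>.\<close>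

lemma not_halved_infinitely_often:
  assumes io: "\<And>m. \<exists>n\<ge>m. \<not> F n \<le> R n - d n / 2 \<and> p n > B"
  shows False
proof -
  have halve: "\<exists>n. d n \<le> d 0 * (1/2) ^ j" for j
  proof (induction j)
    case 0
    show ?case by (rule exI[of _ 0]) simp
  next
    case (Suc j)
    then obtain m where m: "d m \<le> d 0 * (1/2) ^ j" by blast
    obtain n where "n \<ge> m" "d (Suc n) = d n / 2" using io[of m] d_halve by blast
    then have "d (Suc n) \<le> d 0 * (1/2) ^ Suc j" using d_antimono[of m n] m by simp
    then show ?case by blast
  qed
  obtain j where "(1/2) ^ j < \<epsilon> / 2 / d 0"
    using real_arch_pow_inv[of "\<epsilon> / 2 / d 0" "1/2"] \<epsilon> d0 by auto
  then have "d 0 * (1/2) ^ j \<le> \<epsilon> / 2" using d0 by (simp add: field_simps)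
  then obtain K where "d K \<le> \<epsilon> / 2" using halve[of j] by (meson order_trans)
  then have d_small: "d n \<le> \<epsilon> / 2" if "n \<ge> K" for n using d_antimono[OF that] by linarith
  have E_sum: "E (n + K) + (\<Sum>i<n. \<eta> (i + K) * (\<epsilon> / 2)) \<le> E K" for n
  proof (induction n)
    case (Suc n)
    then show ?case using E_descent_small_gap[of "n + K"] d_small[of "Suc (n + K)"] by simp
  qed simp
  have sum_nonneg: "0 \<le> (\<Sum>i<n. \<eta> (i + K) * (\<epsilon> / 2))" for n
    using \<eta>_pos \<epsilon> by (intro sum_nonneg) (simp add: less_imp_le)
  have "E n \<le> E K" if "n \<ge> K" for n
    using E_sum[of "n - K"] sum_nonneg[of "n - K"] that by simp
  then obtain C where "\<And>n. E n \<le> C" using eventually_bounded_imp_bounded[of K E] by blast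
  then obtain \<Gamma> where \<Gamma>: "\<And>n. G n \<le> \<Gamma>" using G_bounded by blast
  have "(\<Sum>i<n. \<eta> (i + K) * (\<epsilon> / 2)) \<le> E K" for n
    using E_sum[of n] E_nonneg[of "n + K"] by linarith
  then have "summable (\<lambda>i. \<eta> (i + K) * (\<epsilon> / 2))"
    using \<eta>_pos \<epsilon> by (intro summableI_nonneg_bounded) (simp_all add: less_imp_le)
  then have "summable (\<lambda>i. \<eta> (i + K))"
    using \<epsilon> summable_cmult_iff[of "\<epsilon> / 2" "\<lambda>i. \<eta> (i + K)"] by (simp add: mult.commute)
  then have "summable \<eta>" by (simp add: summable_iff_shift)
  then have "summable (\<lambda>n. c * \<Gamma> * \<eta> n)" by (rule summable_mult)
  moreover have "norm (c * \<eta> n * G n) \<le> c * \<Gamma> * \<eta> n" for n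
  proof -
    have "c * \<eta> n * G n \<le> c * \<eta> n * \<Gamma>" using \<eta>_pos[of n] c \<Gamma> by (intro mult_left_mono) auto
    then show ?thesis using q_pos[of n] by (simp add: mult_ac)
  qed
  ultimately have "summable (\<lambda>n. c * \<eta> n * G n)" by (rule summable_comparison_test'[of _ 0])
  then obtain K' where K': "\<And>m n. m \<ge> K' \<Longrightarrow> norm (\<Sum>i=m..<n. c * \<eta> i * G i) < B"
    using B unfolding summable_Cauchy by blast
  obtain m where m: "m \<ge> K'" "p m > B" using io by blast
  \<comment> \<open>The reset at \<open>m\<close> makes \<open>p (Suc m)\<close> the single
    increment with index \<open>m\<close>. Later resets only lower the path, so the tail sum remains
    an upper bound.\<close>
  have "p n \<le> (\<Sum>i=m..<n. c * \<eta> i * G i)" if "n \<ge> Suc m" for n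
    using that
  proof (induction n rule: dec_induct)
    case base
    show ?case using p_reset[of m] m(2) by simp
  next
    case (step n)
    then show ?case using p_Suc_le[of n] by simp
  qed
  moreover obtain n where "n \<ge> Suc m" "p n > B" using io by blast
  ultimately show False using K'[OF m(1), of n] by fastforce
qed

text \<open>Without resets the path accumulates but stays within \<open>B\<close>. This bounds
  \<open>E\<close>, hence \<open>G\<close>; with a constant gap the increments are then bounded away
  from 0, which exhausts \<open>B\<close>.\<close>

lemma not_eventually_reset_free:
  assumes keep: "\<And>n. n \<ge> K \<Longrightarrow> \<not> (F n \<le> R n - d n / 2 \<or> p n > B)"
  shows False
proof -
  have p_le: "p n \<le> B" if "n \<ge> K" for n using keep[OF that] by simp
  have q_le: "c * \<eta> n * G n \<le> B" if "n \<ge> K" for n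
    using p_le[of "Suc n"] p_keep[OF keep[OF that]] p_nonneg[of n] that by simp
  \<comment> \<open>With q the path increment, the error (\<eta> G)^2 / 2 is q^2 / (2 c^2), and q is
    at most \<open>B\<close>; so the total error is at most a multiple of the path length.\<close>
  have E_le: "E n \<le> E K + B / (2 * c\<^sup>2) * p n" if "n \<ge> K" for n
    using that
  proof (induction n rule: dec_induct)
    case base
    show ?case using B p_nonneg[of K] by simp
  next
    case (step n)
    have "(\<eta> n * G n)\<^sup>2 / 2 = 1 / (2 * c\<^sup>2) * ((c * \<eta> n * G n) * (c * \<eta> n * G n))"
      using c by (simp add: power2_eq_square field_simps)
    also have "\<dots> \<le> 1 / (2 * c\<^sup>2) * (B * (c * \<eta> n * G n))"
      using q_le[OF step(1)] q_pos[of n] by (intro mult_left_mono mult_right_mono) auto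
    finally have "(\<eta> n * G n)\<^sup>2 / 2 \<le> B / (2 * c\<^sup>2) * (c * \<eta> n * G n)" by simp
    then show ?case
      using step(3) E_ascent_le[of n] p_keep[OF keep[OF step(1)]]
      by (simp only: distrib_left)
  qed
  have "E n \<le> E K + B / (2 * c\<^sup>2) * B" if "n \<ge> K" for n
  proof -
    have "B / (2 * c\<^sup>2) * p n \<le> B / (2 * c\<^sup>2) * B"
      using p_le[OF that] B by (intro mult_left_mono) auto
    then show ?thesis using E_le[OF that] by linarith
  qed
  then obtain C where "\<And>n. E n \<le> C" using eventually_bounded_imp_bounded[of K E] by blast
  then obtain \<Gamma> where \<Gamma>: "\<And>n. G n \<le> \<Gamma>" using G_bounded by blast
  have "\<Gamma> > 0" using \<Gamma>[of 0] G[of 0] by linarith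
  have d_eq: "d n = d K" if "n \<ge> K" for n
    using that
  proof (induction n rule: dec_induct)
    case (step n)
    then show ?case using keep[of n] d_keep[of n] by simp
  qed simp
  have q_ge: "d K / 2 / \<Gamma> \<le> c * \<eta> n * G n" if "n \<ge> K" for n
  proof -
    have "d K / 2 \<le> (c * \<eta> n * G n) * G n"
      using gap[of n] gap_eq[of n] d_eq[of "Suc n"] that by (simp add: power2_eq_square mult.assoc)
    also have "\<dots> \<le> (c * \<eta> n * G n) * \<Gamma>" using q_pos[of n] \<Gamma> by (intro mult_left_mono) auto
    finally show ?thesis using \<open>\<Gamma> > 0\<close> by (simp add: pos_divide_le_eq)
  qed
  have p_ge: "real n * (d K / 2 / \<Gamma>) \<le> p (n + K)" for n
  proof (induction n)
    case 0
    show ?case using p_nonneg[of K] by simp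
  next
    case (Suc n)
    then show ?case using q_ge[of "n + K"] p_keep[OF keep[of "n + K"]]
      by (simp add: distrib_right add_divide_distrib)
  qed
  have "0 < d K / 2 / \<Gamma>" using d_pos[of K] \<open>\<Gamma> > 0\<close> by simp
  then obtain n where "B < real n * (d K / 2 / \<Gamma>)" using reals_Archimedean3 by blast
  then show False using p_ge[of n] p_le[of "n + K"] by simp
qed

theorem contradiction: False
proof (cases "\<forall>m. \<exists>n\<ge>m. \<not> F n \<le> R n - d n / 2 \<and> p n > B")
  case True
  then show False using not_halved_infinitely_often by blast
next
  case False
  then obtain m where m: "\<And>n. n \<ge> m \<Longrightarrow> F n \<le> R n - d n / 2 \<or> \<not> p n > B" by blast
  have d_eq: "d n = d m" if "n \<ge> m" for n
    using that
  proof (induction n rule: dec_induct)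
    case (step n)
    then show ?case using m[of n] d_keep[of n] by simp
  qed simp
  show False
  proof (cases "\<forall>K. \<exists>n\<ge>K. F n \<le> R n - d n / 2")
    case True
    \<comment> \<open>Every sufficient decrease lowers the reference by at least half the constant
      gap, so infinitely many would violate \<open>R_lower\<close>.\<close>
    have "\<exists>n\<ge>m. R n \<le> R m - real j * (d m / 2)" for j
    proof (induction j)
      case (Suc j)
      then obtain k where k: "k \<ge> m" "R k \<le> R m - real j * (d m / 2)" by blast
      obtain n where n: "n \<ge> k" "F n \<le> R n - d n / 2" using True by blast
      have "R (Suc n) \<le> R m - real (Suc j) * (d m / 2)"
      proof -
        have "real (Suc j) * (d m / 2) = real j * (d m / 2) + d n / 2"
          using d_eq[of n] n k by (simp add: field_simps)
        then show ?thesis using R_reset[of n] n R_antimono[OF n(1)] k by linarith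
      qed
      then show ?case using n k by (intro exI[of _ "Suc n"]) auto
    qed auto
    moreover obtain j where "R m - (\<alpha> + \<epsilon>) < real j * (d m / 2)"
      using reals_Archimedean3[of "d m / 2"] d_pos[of m] half_gt_zero by blast
    ultimately show False using R_lower by (smt (verit))
  next
    case False
    then obtain K where K: "\<And>n. n \<ge> K \<Longrightarrow> \<not> F n \<le> R n - d n / 2" by blast
    \<comment> \<open>Beyond both indices there is no sufficient decrease, and hence by
      \<open>m\<close> no exceeded budget: no reset at all.\<close>
    show False
      by (rule not_eventually_reset_free[of "max K m"]) (use K m in fastforce)
  qed
qed

end

subsection \<open>Runs of the algorithm\<close>

locale mirror_level = legendre_mirror h X N
  for h :: "'a::euclidean_space \<Rightarrow> ereal" and X and N +
  fixes f :: "'a \<Rightarrow> ereal" and g :: "'a \<Rightarrow> 'a" and T :: "'a \<Rightarrow> real \<Rightarrow> 'a" and \<delta>1 B c :: real and x1 :: 'a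
  assumes proper_f: "proper_fun f" and convex_f: "convex_fun f"
    and subgradient: "\<And>x. x \<in> X \<inter> interior dom \<Longrightarrow> g x \<in> subdifferential f x"
    and dom_f: "X \<inter> effective_domain f \<subseteq> closure dom"
    and g_bounded: "\<And>K. compact K \<Longrightarrow> K \<subseteq> X \<inter> interior dom \<Longrightarrow> bounded (g ` K)"
    and T: "\<And>x \<eta>. x \<in> X \<inter> interior dom \<Longrightarrow> \<eta> > 0 \<Longrightarrow>
        \<exists>z. mirror_descent_solution X h g x \<eta> z \<Longrightarrow> mirror_descent_solution X h g x \<eta> (T x \<eta>)"
    and params: "\<delta>1 > 0" "B > 0" "c > 1 / 2"
    and x1: "x1 \<in> X \<inter> interior dom"
begin

definition F :: "'a \<Rightarrow> real" where "F x = real_of_ereal (f x)"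

text \<open>A subgradient at a point of infinite value would force \<open>f\<close> to be infinite
  everywhere, against properness.\<close>

lemma f_eq:
  assumes "x \<in> X \<inter> interior dom" shows "f x = ereal (F x)"
proof -
  have "f x \<noteq> \<infinity>"
  proof
    assume "f x = \<infinity>"
    then have "f y = \<infinity>" for y
      using subgradient[OF assms] by (auto simp: subdifferential_def split: if_splits)
    then show False using proper_f by (simp add: proper_fun_def effective_domain_def)
  qed
  moreover have "f x \<noteq> -\<infinity>" using proper_f by (simp add: proper_fun_def)
  ultimately show ?thesis by (cases "f x") (auto simp: F_def)
qed

lemma F_subgradient:
  assumes "x \<in> X \<inter> interior dom" "y \<in> X \<inter> interior dom"
  shows "F x - F y \<le> g x \<bullet> (x - y)"
proof -
  have "f x + ereal (g x \<bullet> (y - x)) \<le> f y"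
    using subgradient[OF assms(1)] by (simp add: subdifferential_def)
  then have "F x + g x \<bullet> (y - x) \<le> F y" using assms by (simp add: f_eq)
  then show ?thesis by (simp add: inner_diff_right)
qed

text \<open>The hypothesis on \<open>T\<close> is conditional on solvability, which
  \<open>mirror_minimizer_exists\<close> supplies.\<close>

lemma T_minimizer:
  assumes "x \<in> X \<inter> interior dom" "\<eta> > 0"
  shows "is_arg_min (obj (g x) x \<eta>) (\<lambda>y. y \<in> X) (T x \<eta>)"
  using T[OF assms] mirror_minimizer_exists[of x \<eta> "g x"] assms
  unfolding mirror_descent_solution_def obj_def[abs_def] by blast

section \<open>From the memory of the algorithm to real sequences\<close>

definition ref :: "'a md_state \<Rightarrow> real" where
  "ref s = Min ((\<lambda>\<kappa>. F (iter s \<kappa>)) ` {1..mark s (counter s)})"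

definition gap :: "'a md_state \<Rightarrow> real" where
  "gap s = level s (counter s)"

text \<open>An invariant, preserved by the level adjustment, that makes values finite and the
  minimum in \<open>ref\<close> range over a nonempty set of iterates already computed.\<close>

definition valid :: "nat \<Rightarrow> 'a md_state \<Rightarrow> bool" where
  "valid k s \<longleftrightarrow> 1 \<le> k \<and> (\<forall>\<kappa>\<in>{1..k}. iter s \<kappa> \<in> X \<inter> interior dom) \<and>
     1 \<le> mark s (counter s) \<and> mark s (counter s) \<le> k \<and> 0 < gap s"

lemma f_rec_eq:
  assumes "valid k s"
  shows "f_rec f s (mark s (counter s)) = ereal (ref s)"
proof -
  have ne: "{1..mark s (counter s)} \<noteq> {}" using assms by (auto simp: valid_def)
  have "(\<lambda>\<kappa>. f (iter s \<kappa>)) ` {1..mark s (counter s)} = ereal ` (\<lambda>\<kappa>. F (iter s \<kappa>)) ` {1..mark s (counter s)}"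
    unfolding image_image using assms by (intro image_cong refl f_eq) (auto simp: valid_def)
  moreover have "mono ereal" by (simp add: mono_def)
  ultimately show ?thesis
    unfolding f_rec_def ref_def using ne by (simp add: mono_Min_commute)
qed

definition resets :: "nat \<Rightarrow> 'a md_state \<Rightarrow> bool" where
  "resets k s \<longleftrightarrow> F (iter s k) \<le> ref s - gap s / 2 \<or> path s k > B"

lemma adjust_level_eq:
  assumes "valid k s"
  shows "adjust_level f B k s =
    (if F (iter s k) \<le> ref s - gap s / 2 then new_level k (gap s) s
     else if path s k > B then new_level k (gap s / 2) s else s)"
proof -
  have "f (iter s k) = ereal (F (iter s k))" using assms by (intro f_eq) (auto simp: valid_def)
  then show ?thesis
    using f_rec_eq[OF assms] by (simp add: adjust_level_def Let_def gap_def)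
qed

lemma adjust_level_props:
  assumes "valid k s"
  defines "s' \<equiv> adjust_level f B k s"
  shows "iter s' = iter s" and "valid k s'"
    and "resets k s \<Longrightarrow> ref s' \<le> F (iter s k)"
    and "\<not> resets k s \<Longrightarrow> ref s' = ref s"
    and "ref s' \<le> ref s"
    and "gap s' = (if \<not> F (iter s k) \<le> ref s - gap s / 2 \<and> path s k > B then gap s / 2 else gap s)"
    and "path s' k = (if resets k s then 0 else path s k)"
proof -
  have s': "s' = (if F (iter s k) \<le> ref s - gap s / 2 then new_level k (gap s) s
     else if path s k > B then new_level k (gap s / 2) s else s)"
    unfolding s'_def by (rule adjust_level_eq[OF assms(1)])
  show it: "iter s' = iter s" by (simp add: s' new_level_def)
  show "valid k s'" using assms(1) by (auto simp: s' new_level_def valid_def gap_def)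
  have k: "1 \<le> k" "1 \<le> mark s (counter s)" "mark s (counter s) \<le> k"
    using assms(1) by (auto simp: valid_def)
  have mark: "mark s' (counter s') = (if resets k s then k else mark s (counter s))"
    by (simp add: s' new_level_def resets_def)
  show "resets k s \<Longrightarrow> ref s' \<le> F (iter s k)"
    unfolding ref_def mark it using k by (intro Min_le) auto
  show "\<not> resets k s \<Longrightarrow> ref s' = ref s" by (simp add: ref_def mark it)
  \<comment> \<open>The marked index never moves backwards, so the minimum is taken over a larger
    set.\<close>
  show "ref s' \<le> ref s"
    unfolding ref_def mark it using k by (intro Min_antimono image_mono) auto
  show "gap s' = (if \<not> F (iter s k) \<le> ref s - gap s / 2 \<and> path s k > B then gap s / 2 else gap s)"
    by (simp add: s' new_level_def gap_def)
  show "path s' k = (if resets k s then 0 else path s k)"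
    by (simp add: s' new_level_def resets_def)
qed

lemma step_size_eq:
  assumes "valid k s"
  shows "step_size f g N c k s = (F (iter s k) - (ref s - gap s)) / (c * (dual_norm N (g (iter s k)))\<^sup>2)"
proof -
  have "f (iter s k) = ereal (F (iter s k))" using assms by (intro f_eq) (auto simp: valid_def)
  then show ?thesis
    using f_rec_eq[OF assms] by (simp add: step_size_def Let_def gap_def)
qed

text \<open>After a reset the reference is at most the current value; otherwise the failed decrease
  test keeps the value above the target.\<close>

lemma step_size_pos:
  assumes "valid k s" "g (iter s k) \<noteq> 0"
  shows "step_size f g N c k (adjust_level f B k s) > 0"
proof -
  note props = adjust_level_props[OF assms(1)]
  define s' where "s' = adjust_level f B k s"
  have "0 < gap s" "0 < gap s'" using assms(1) props(2) by (auto simp: valid_def s'_def)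
  then have "0 < F (iter s k) - (ref s' - gap s')"
    using props(3,4,6) unfolding s'_def[symmetric] by (cases "resets k s") (auto simp: resets_def)
  moreover have "0 < c * (dual_norm N (g (iter s k)))\<^sup>2"
    using dual_norm_pos[OF norm_N assms(2)] params by simp
  ultimately show ?thesis
    unfolding step_size_eq[OF props(2)] props(1) s'_def by (rule divide_pos_pos)
qed

lemma valid_advance:
  assumes "valid k s" "step_size f g N c k s > 0"
  shows "valid (k + 1) (advance f g N T c k s)"
proof -
  define \<eta> where "\<eta> = step_size f g N c k s"
  have x: "iter s k \<in> X \<inter> interior dom" using assms(1) by (auto simp: valid_def)
  have "T (iter s k) \<eta> \<in> X \<inter> interior dom"
    using mirror_minimizer_interior[OF _ _ _ T_minimizer[OF x]] x assms(2) by (auto simp: \<eta>_def)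
  then show ?thesis
    using assms(1) unfolding valid_def advance_def Let_def \<eta>_def[symmetric]
    by (auto simp: gap_def)
qed

lemma md_reaches_valid:
  "md_reaches f g N T \<delta>1 B c x1 k s \<Longrightarrow> valid k s"
proof (induction rule: md_reaches.induct)
  case start
  show ?case using x1 params by (simp add: valid_def md_init_def gap_def)
next
  case (step k s)
  then show ?case
    using valid_advance[OF adjust_level_props(2) step_size_pos] by blast
qed

text \<open>Omits the termination test to obtain a total sequence. The algorithm counts from 1, so
  \<open>run n\<close> is the memory on entering iteration n + 1.\<close>

primrec run :: "nat \<Rightarrow> 'a md_state" where
  "run 0 = md_init \<delta>1 x1"
| "run (Suc n) = advance f g N T c (Suc n) (adjust_level f B (Suc n) (run n))"

lemma md_reaches_run:
  assumes "\<And>k s. md_reaches f g N T \<delta>1 B c x1 k s \<Longrightarrow> g (iter s k) \<noteq> 0"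
  shows "md_reaches f g N T \<delta>1 B c x1 (Suc n) (run n)"
proof (induction n)
  case 0
  show ?case using md_reaches.start by simp
next
  case (Suc n)
  then show ?case using md_reaches.step[OF Suc assms[OF Suc]] by simp
qed

text \<open>Points of \<open>X\<close> where \<open>f\<close> is finite may be moved towards \<open>x1\<close>, into the interior of the domain of \<open>h\<close>.\<close>

lemma interior_comparison_point:
  assumes "y0 \<in> X" "f y0 < I"
  obtains y \<epsilon> where "y \<in> X \<inter> interior dom" "\<epsilon> > 0" "ereal (F y + \<epsilon>) < I"
proof -
  have fx1: "x1 \<in> effective_domain f" using f_eq[OF x1] by (simp add: effective_domain_def)
  have "f y0 \<noteq> \<infinity>" using assms(2) by auto
  then have y0: "y0 \<in> effective_domain f" by (simp add: effective_domain_def)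
  note cf = convex_fun_domain[OF proper_f convex_f]
  have fy0: "f y0 = ereal (F y0)" using cf(3)[OF y0] by (simp add: F_def)
  \<comment> \<open>A value strictly between leaves room for the margin
    \<open>\<epsilon> = \<beta> - F y\<close> after moving \<open>y0\<close> slightly towards
    \<open>x1\<close>.\<close>
  obtain \<beta> where \<beta>: "F y0 < \<beta>" "ereal \<beta> < I" using ereal_dense2[of "f y0" I] assms(2) fy0 by auto
  have "((\<lambda>t. (1 - t) * F y0 + t * F x1) \<longlongrightarrow> (1 - 0) * F y0 + 0 * F x1) (at_right 0)"
    by (intro tendsto_intros)
  then have "eventually (\<lambda>t. (1 - t) * F y0 + t * F x1 < \<beta>) (at_right 0)"
    using \<beta>(1) by (intro order_tendstoD(2)) auto
  moreover have "eventually (\<lambda>t::real. 0 < t \<and> t < 1) (at_right 0)"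
    using eventually_at_right_real[of 0 "1::real"] by simp
  ultimately have "eventually (\<lambda>t. (1 - t) * F y0 + t * F x1 < \<beta> \<and> 0 < t \<and> t < 1) (at_right 0)"
    by eventually_elim simp
  then obtain t where t: "(1 - t) * F y0 + t * F x1 < \<beta>" "0 < t" "t < 1"
    using eventually_happens[of _ "at_right (0::real)"] by auto
  define y where "y = y0 + t *\<^sub>R (x1 - y0)"
  have y: "y \<in> X \<inter> interior dom"
    using shrink[of x1 y0 t] convex_X_line[of x1 y0 t] dom_f assms(1) y0 x1 t unfolding y_def by auto
  have "y = (1 - t) *\<^sub>R y0 + t *\<^sub>R x1" by (simp add: y_def algebra_simps)
  then have "F y \<le> (1 - t) * F y0 + t * F x1"
    using cf(2) y0 fx1 t unfolding convex_on_def F_def[abs_def] by simp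
  then have "F y < \<beta>" using t by simp
  then show thesis using y \<beta>(2) that[of y "\<beta> - F y"] by simp
qed

text \<open>Such a run yields an instance of \<open>level_control\<close>, which is inconsistent.
  The Bregman divergence from \<open>y\<close> serves as \<open>E\<close>, and the compactness of
  its bounded orbits supplies the bound on \<open>G\<close>.\<close>

lemma nonterminating_contradiction:
  assumes nonzero: "\<And>k s. md_reaches f g N T \<delta>1 B c x1 k s \<Longrightarrow> g (iter s k) \<noteq> 0"
    and y: "y \<in> X \<inter> interior dom" and \<epsilon>: "\<epsilon> > 0"
    and lower: "\<And>x. x \<in> md_iterates f g N T \<delta>1 B c x1 \<Longrightarrow> F y + \<epsilon> \<le> F x"
  shows False
proof -
  note reach = md_reaches_run[OF nonzero]
  note valid = md_reaches_valid[OF reach]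
  define x where "x n = iter (run n) (Suc n)" for n
  define s' where "s' n = adjust_level f B (Suc n) (run n)" for n
  define \<eta> where "\<eta> n = step_size f g N c (Suc n) (s' n)" for n
  note props = adjust_level_props[OF valid, folded s'_def]
  have nz: "g (x n) \<noteq> 0" for n using nonzero[OF reach] by (simp add: x_def)
  have x_in: "x n \<in> X \<inter> interior dom" for n using valid[of n] by (auto simp: valid_def x_def)
  have \<eta>_pos: "\<eta> n > 0" for n
    unfolding \<eta>_def s'_def using step_size_pos[OF valid] nz by (simp add: x_def)
  have iter_s': "iter (s' n) = iter (run n)" for n by (rule props(1))
  have run_Suc: "iter (run (Suc n)) = (iter (run n))(Suc (Suc n) := T (x n) (\<eta> n))"
    "path (run (Suc n)) (Suc (Suc n)) = path (s' n) (Suc n) + c * \<eta> n * dual_norm N (g (x n))"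
    "mark (run (Suc n)) = mark (s' n)" "counter (run (Suc n)) = counter (s' n)"
    "gap (run (Suc n)) = gap (s' n)" for n
    by (simp_all add: s'_def[symmetric] advance_def Let_def \<eta>_def[symmetric] iter_s' x_def gap_def)
  have x_Suc: "x (Suc n) = T (x n) (\<eta> n)" for n
    unfolding x_def[of "Suc n"] run_Suc by simp
  have iter_run: "iter (run n) \<kappa> = x (\<kappa> - 1)" if "\<kappa> \<in> {1..Suc n}" for n \<kappa>
    using that
  proof (induction n)
    case (Suc n)
    then show ?case by (cases "\<kappa> = Suc (Suc n)") (auto simp: x_def[of "Suc n"] run_Suc simp del: run.simps)
  qed (simp add: x_def)
  have F_x: "F y + \<epsilon> \<le> F (x n)" for n
    using lower reach unfolding md_iterates_def x_def by blast
  \<comment> \<open>The new iterate is written at index n + 2, beyond every index that enters the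
    reference minimum.\<close>
  have ref_Suc: "ref (run (Suc n)) = ref (s' n)" for n
  proof -
    have "mark (s' n) (counter (s' n)) \<le> Suc n" using props(2)[of n] by (simp add: valid_def)
    then show ?thesis
      unfolding ref_def run_Suc iter_s' by (intro arg_cong[of _ _ Min] image_cong) auto
  qed
  have ref_lower: "F y + \<epsilon> \<le> ref (run n)" for n
    unfolding ref_def using valid[of n] F_x iter_run
    by (subst Min_ge_iff) (auto simp: valid_def)
  have minimizer: "is_arg_min (obj (g (x n)) (x n) (\<eta> n)) (\<lambda>y. y \<in> X) (x (Suc n))" for n
    unfolding x_Suc by (rule T_minimizer[OF x_in \<eta>_pos])
  obtain L where L: "\<And>z. dual_norm N z \<le> L * norm z" using dual_norm_upper_bound[OF norm_N] by blast
  interpret level_control "\<lambda>n. F (x n)" "\<lambda>n. ref (run n)" "\<lambda>n. gap (run n)"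
    "\<lambda>n. path (run n) (Suc n)" \<eta> "\<lambda>n. dual_norm N (g (x n))" "\<lambda>n. breg y (x n)" B c "F y" \<epsilon>
  proof
    show "B > 0" "c > 1/2" "\<epsilon> > 0" using params \<epsilon> by auto
    show "gap (run 0) > 0" "path (run 0) (Suc 0) = 0"
      using params by (simp_all add: gap_def md_init_def)
    fix n
    have resets: "resets (Suc n) (run n) \<longleftrightarrow>
        F (x n) \<le> ref (run n) - gap (run n) / 2 \<or> path (run n) (Suc n) > B"
      by (simp add: resets_def x_def)
    show "ref (run (Suc n)) \<le> F (x n)"
      if "F (x n) \<le> ref (run n) - gap (run n) / 2 \<or> path (run n) (Suc n) > B"
      using props(3) that unfolding resets[symmetric] ref_Suc by (simp add: x_def)
    show "ref (run (Suc n)) = ref (run n)"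
      if "\<not> (F (x n) \<le> ref (run n) - gap (run n) / 2 \<or> path (run n) (Suc n) > B)"
      using props(4) that unfolding resets[symmetric] ref_Suc by simp
    show "ref (run (Suc n)) \<le> ref (run n)" unfolding ref_Suc by (rule props(5))
    show "F y + \<epsilon> \<le> ref (run n)" by (rule ref_lower)
    show "gap (run (Suc n)) = gap (run n) / 2"
      if "\<not> F (x n) \<le> ref (run n) - gap (run n) / 2" "path (run n) (Suc n) > B"
      using that props(6)[of n] by (simp add: run_Suc(5) x_def del: run.simps)
    show "gap (run (Suc n)) = gap (run n)"
      if "F (x n) \<le> ref (run n) - gap (run n) / 2 \<or> \<not> path (run n) (Suc n) > B"
      using that props(6)[of n] by (auto simp: run_Suc(5) x_def simp del: run.simps)
    show "path (run (Suc n)) (Suc (Suc n)) = c * \<eta> n * dual_norm N (g (x n))"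
      if "F (x n) \<le> ref (run n) - gap (run n) / 2 \<or> path (run n) (Suc n) > B"
      using that props(7)[of n] unfolding resets[symmetric] by (simp add: run_Suc(2) del: run.simps)
    show "path (run (Suc n)) (Suc (Suc n)) = path (run n) (Suc n) + c * \<eta> n * dual_norm N (g (x n))"
      if "\<not> (F (x n) \<le> ref (run n) - gap (run n) / 2 \<or> path (run n) (Suc n) > B)"
      using that props(7)[of n] unfolding resets[symmetric] by (simp add: run_Suc(2) del: run.simps)
    show "dual_norm N (g (x n)) > 0" by (rule dual_norm_pos[OF norm_N nz])
    show "\<eta> n = (F (x n) - (ref (run (Suc n)) - gap (run (Suc n)))) / (c * (dual_norm N (g (x n)))\<^sup>2)"
      using step_size_eq[OF props(2), of n] unfolding \<eta>_def[symmetric]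
      by (simp only: run_Suc(5) ref_Suc iter_s' x_def)
    show "breg y (x n) \<ge> 0" using breg_nonneg[of "x n" y] x_in[of n] y interior_dom[of y] by simp
    \<comment> \<open>The subgradient inequality replaces the linear term of
      \<open>mirror_step_descent\<close> by a difference of values.\<close>
    have "\<eta> n * (F (x n) - F y) \<le> \<eta> n * (g (x n) \<bullet> (x n - y))"
      using F_subgradient[OF x_in[of n] y] \<eta>_pos[of n] by (intro mult_left_mono) auto
    then show "breg y (x (Suc n)) \<le> breg y (x n) - \<eta> n * (F (x n) - F y) +
        (\<eta> n * dual_norm N (g (x n)))\<^sup>2 / 2"
      using mirror_step_descent[OF IntD1[OF x_in] IntD2[OF x_in] \<eta>_pos minimizer IntD1[OF y] IntD2[OF y], of n]
      by linarith
    show "F y + \<epsilon> \<le> F (x n)" by (rule F_x)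
  next
    fix C assume "\<And>n. breg y (x n) \<le> C"
    then have "compact (closure (range x))" "closure (range x) \<subseteq> X \<inter> interior dom"
      by (rule breg_bounded_compact[OF IntD1[OF y] IntD2[OF y] IntD1[OF x_in] IntD2[OF x_in]])+
    then have "bounded (g ` closure (range x))" by (rule g_bounded)
    then obtain b where "\<forall>v\<in>g ` closure (range x). norm v \<le> b" unfolding bounded_iff ..
    then have b: "\<And>z. z \<in> closure (range x) \<Longrightarrow> norm (g z) \<le> b" by simp
    have "dual_norm N (g (x n)) \<le> \<bar>L\<bar> * b" for n
    proof -
      have "x n \<in> closure (range x)" using closure_subset[of "range x"] by blast
      then have "norm (g (x n)) \<le> b" by (rule b)
      then have "\<bar>L\<bar> * norm (g (x n)) \<le> \<bar>L\<bar> * b" by (intro mult_left_mono) auto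
      moreover have "L * norm (g (x n)) \<le> \<bar>L\<bar> * norm (g (x n))" by (intro mult_right_mono) auto
      ultimately show ?thesis using L[of "g (x n)"] by linarith
    qed
    then show "\<exists>\<Gamma>. \<forall>n. dual_norm N (g (x n)) \<le> \<Gamma>" by blast
  qed
  show False by (rule contradiction)
qed

text \<open>One inequality holds since iterates lie in \<open>X\<close>. For the other, a point of
  \<open>X\<close> below all iterates is moved into the interior with a margin, and the run is shown
  to be infinite.\<close>

theorem INF_iterates: "(INF x \<in> md_iterates f g N T \<delta>1 B c x1. f x) = (INF x\<in>X. f x)"
proof (rule antisym)
  have iterates: "x \<in> X \<inter> interior dom" if "x \<in> md_iterates f g N T \<delta>1 B c x1" for x
    using that md_reaches_valid by (fastforce simp: md_iterates_def valid_def)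
  then show "(INF x\<in>X. f x) \<le> (INF x \<in> md_iterates f g N T \<delta>1 B c x1. f x)"
    by (intro INF_superset_mono) auto
  show "(INF x \<in> md_iterates f g N T \<delta>1 B c x1. f x) \<le> (INF x\<in>X. f x)" (is "?I \<le> _")
  proof (rule ccontr)
    assume "\<not> ?I \<le> (INF x\<in>X. f x)"
    then obtain y0 where y0: "y0 \<in> X" "f y0 < ?I" by (auto simp: not_le INF_less_iff)
    then obtain y \<epsilon> where y: "y \<in> X \<inter> interior dom" "\<epsilon> > 0" "ereal (F y + \<epsilon>) < ?I"
      by (rule interior_comparison_point)
    \<comment> \<open>A zero subgradient makes the iterate a global minimizer of \<open>f\<close>,
      contradicting the smaller value at \<open>y0\<close>.\<close>
    have nonzero: "g (iter s k) \<noteq> 0" if "md_reaches f g N T \<delta>1 B c x1 k s" for k s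
    proof
      assume "g (iter s k) = 0"
      moreover have it: "iter s k \<in> md_iterates f g N T \<delta>1 B c x1"
        using that by (auto simp: md_iterates_def)
      ultimately have "f (iter s k) \<le> f y0"
        using subgradient[OF iterates[OF it]] by (simp add: subdifferential_def)
      moreover have "?I \<le> f (iter s k)" using it by (rule INF_lower)
      ultimately show False using y0(2) by simp
    qed
    have "F y + \<epsilon> \<le> F x" if "x \<in> md_iterates f g N T \<delta>1 B c x1" for x
      using less_le_trans[OF y(3) INF_lower[OF that]] by (simp add: f_eq[OF iterates[OF that]])
    with nonzero y(1,2) show False by (rule nonterminating_contradiction)
  qed
qed

end

theorem theorem4p1:
  fixes f h :: "real ^ 'd \<Rightarrow> ereal"
    and X :: "(real ^ 'd) set"
    and f_star :: ereal
    and N :: "real ^ 'd \<Rightarrow> real"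
    and g :: "real ^ 'd \<Rightarrow> real ^ 'd"
    and T :: "real ^ 'd \<Rightarrow> real \<Rightarrow> real ^ 'd"
    and \<delta>1 B c :: real
    and x1 :: "real ^ 'd"
  assumes f: "proper_fun f" "closed_fun f" "convex_fun f"
    and X: "X \<noteq> {}" "closed X" "convex X"
    and f_star: "f_star = (INF x\<in>X. f x)"
    and h: "\<forall>x. h x \<noteq> -\<infinity>" "convex_fun h"
    and N: "is_norm N"
    and g: "\<forall>x \<in> X \<inter> interior (effective_domain h). g x \<in> subdifferential f x"
    and f_star_finite: "\<bar>f_star\<bar> \<noteq> \<infinity>"
    and legendre: "legendre_fun h"
    and dom_f: "X \<inter> effective_domain f \<subseteq> closure (effective_domain h)"
    and ri_dom_f: "X \<inter> interior (effective_domain h) \<subseteq> rel_interior (effective_domain f)"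
    and strong: "\<forall>x \<in> X \<inter> interior (effective_domain h). \<forall>y \<in> X \<inter> interior (effective_domain h).
        bregman h x y \<ge> ereal (1 / 2 * (N (y - x))\<^sup>2)"
    and g_bounded: "\<forall>K. compact K \<and> K \<subseteq> X \<inter> interior (effective_domain h) \<longrightarrow> bounded (g ` K)"
    and params: "\<delta>1 > 0" "B > 0" "c > 1 / 2"
    and x1: "x1 \<in> X \<inter> interior (effective_domain h)"
    \<comment> \<open>\<open>T x \<eta>\<close> is an arbitrary selection of solutions; that a solution exists is not assumed.\<close>
    and T: "\<forall>x \<in> X \<inter> interior (effective_domain h). \<forall>\<eta>>0.
        (\<exists>z. mirror_descent_solution X h g x \<eta> z) \<longrightarrow> mirror_descent_solution X h g x \<eta> (T x \<eta>)"
  shows "(INF x \<in> md_iterates f g N T \<delta>1 B c x1. f x) = f_star"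
proof -
  interpret mirror_level h X N f g T \<delta>1 B c x1
    by unfold_locales (use assms in blast)+
  show ?thesis unfolding f_star by (rule INF_iterates)
qed

end
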